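(* Let $k\ge 2$ be a fixed integer, and for integers $a\ge 1$ write $n_a=\sum_{j=0}^{a}2^j$. For any real-valued function $d(a)$ of $a\ge 1$ satisfying $2-\frac{2}{n_a}\le d(a)\le n_a-1$ for all $a$, there exists a sequence of connected graphs $G_a$, where $G_a$ has $n_a$ vertices and average degree $d_a$, such that $$P(G_a,k)=\Theta_k\big((\log n_a+d(a)^2)^{k-1}\big),$$ and moreover: if $d(a)$ tends to infinity as $a\to\infty$, then $\lim_{a\to\infty}\frac{d_a}{d(a)}=1$; otherwise $\frac{d_a}{d(a)}=\Theta(1)$.
   Context: Graphs are finite and simple; a graph with $n$ vertices and $m$ edges has average degree $2m/n$, and $e(G)$ denotes the number of edges of $G$. For a graph $G$, a connected $(m_1,\dots,m_k)$-edge partition, where $\sum_{i=1}^k m_i=e(G)$, is a partition $E(G)=E_1\cup\dots\cup E_k$ with $|E_i|=m_i$ for all $i$ such that every $E_i$ forms a connected graph on the vertex set $\bigcup_{e\in E_i}e$ (the set of endpoints of the edges in $E_i$). For a connected graph $G$ and an integer $k\ge 2$, $P(G,k)$ is the number of integer $k$-tuples $(m_1,\dots,m_k)$ with $m_1\ge m_2\ge\dots\ge m_k\ge 1$ for which there exists a connected $(m_1,\dots,m_k)$-edge partition of $G$. Asymptotic notation is as $a\to\infty$: $f(a)=\Theta_k(g(a))$ means that there are constants $0<c\le C$ depending only on $k$ with $c\,g(a)\le f(a)\le C\,g(a)$ for all sufficiently large $a$; $f(a)=\Theta(1)$ means that $f(a)$ is bounded between two positive constants for all sufficiently large $a$. 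*)

theory Defs imports Complex_Main begin

record 'v ugraph =
  verts :: "'v set"
  edges :: "'v set set"

definition simple_graph :: "'v ugraph \<Rightarrow> bool" where
  "simple_graph G \<longleftrightarrow> finite (verts G) \<and> (\<forall>e\<in>edges G. e \<subseteq> verts G \<and> card e = 2)"

definition adj :: "'v ugraph \<Rightarrow> ('v \<times> 'v) set" where
  "adj G = {(u, v). {u, v} \<in> edges G}"

definition connected_graph :: "'v ugraph \<Rightarrow> bool" where
  "connected_graph G \<longleftrightarrow> (\<forall>u\<in>verts G. \<forall>v\<in>verts G. (u, v) \<in> (adj G)\<^sup>*)"

definition avg_degree :: "'v ugraph \<Rightarrow> real" where
  "avg_degree G = 2 * real (card (edges G)) / real (card (verts G))"

definition edge_induced :: "'v set set \<Rightarrow> 'v ugraph" where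
  "edge_induced F = \<lparr>verts = \<Union>F, edges = F\<rparr>"

definition connected_edge_partition :: "'v ugraph \<Rightarrow> nat list \<Rightarrow> 'v set set list \<Rightarrow> bool" where
  "connected_edge_partition G ms Es \<longleftrightarrow>
     sum_list ms = card (edges G) \<and>
     length Es = length ms \<and>
     \<Union> (set Es) = edges G \<and>
     (\<forall>i<length Es. \<forall>j<length Es. i \<noteq> j \<longrightarrow> Es ! i \<inter> Es ! j = {}) \<and>
     (\<forall>i<length Es. card (Es ! i) = ms ! i \<and> connected_graph (edge_induced (Es ! i)))"

definition P :: "'v ugraph \<Rightarrow> nat \<Rightarrow> nat" where
  "P G k = card {ms :: nat list. length ms = k \<and> sorted_wrt (\<ge>) ms \<and> (\<forall>m\<in>set ms. m \<ge> 1) \<and>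
                   (\<exists>Es. connected_edge_partition G ms Es)}"

definition num_verts :: "nat \<Rightarrow> nat" where
  "num_verts a = (\<Sum>j=0..a. 2 ^ j)"

text \<open>
  The constants are explicit, unlike in the library's \<open>\<Theta>\<close>, so that a statement can
  say which parameters they may depend on.
\<close>
definition Theta_with :: "real \<Rightarrow> real \<Rightarrow> (nat \<Rightarrow> real) \<Rightarrow> (nat \<Rightarrow> real) \<Rightarrow> bool" where
  "Theta_with c C f g \<longleftrightarrow> 0 < c \<and> c \<le> C \<and>
     (\<forall>\<^sub>F a in sequentially. c * g a \<le> f a \<and> f a \<le> C * g a)"

end

theory Submission imports Defs "HOL-Library.Multiset" "HOL-Library.Disjoint_Sets" begin

text \<open>
  Write \<open>h = 2^j - 1\<close> for the least \<open>j\<close> with \<open>d(a) \<le> 2^j - 2\<close>, so that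
  \<open>d(a) + 1 \<le> h < 2 d(a) + 3\<close>. In the complete binary tree on \<open>n\<^sub>a\<close> vertices, replace each of
  the lowest subtrees on \<open>h\<close> vertices by a copy of one connected graph \<open>H\<close> with
  \<open>\<lfloor>h d(a) / 2\<rfloor>\<close> edges. This keeps the number of vertices and gives average degree close to \<open>d(a)\<close>.

  Upper bound: a partition of a rooted subtree into connected parts either cuts only one of its two
  branches, or distributes the cuts over both of them, or separates parts at the root. All subtrees
  on one level being isomorphic, an induction on the number of parts shows that \<open>k\<close> parts leave only
  \<open>O((log n\<^sub>a + e(H))\<^bsup>k-1\<^esup>)\<close> possibilities for the sizes.

  Lower bound: if \<open>d(a)\<^sup>2 \<le> log n\<^sub>a\<close>, cut off whole subtrees on \<open>k - 1\<close> different levels.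
  Otherwise let \<open>H\<close> contain \<open>k\<close> hubs adjacent to all vertices; giving a part all edges at its hub
  makes it connected whatever other edges it receives, so the sizes of \<open>k - 1\<close> parts inside one
  copy of \<open>H\<close> can be prescribed freely.
\<close>

section \<open>Connected edge sets\<close>

text \<open>A part that is cut off is described by a level of the tree or by a number of edges of
  \<open>H\<close>, so each of the \<open>k - 1\<close> free sizes should range over about
  \<open>a + e(H)\<close> values. This dictates the shape of \<open>H\<close>: of the order of
  \<open>d\<close> vertices and of \<open>d^2\<close> edges. Its number of vertices has to be one
  less than a power of two in order to fill the tree exactly and may exceed \<open>d\<close> by a
  factor of about two. Hence \<open>H\<close> is in general not complete, and the average degree is
  tuned through the number of its edges alone.

  The obstacle in the upper bound is that a recursion over the levels would multiply the counts of
  the two branches at each of about \<open>log n\<close> levels. It is avoided by counting for a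
  fixed number of parts, over all levels at once. An edge planted above the root marks the one part
  whose size is left implicit, and turns both branches at a vertex into copies of the planted tree
  one level lower; it is removed at the end. Working with multisets of the remaining sizes instead
  of sorted tuples costs only a factor \<open>k\<close> in the lower bound.\<close>

text \<open>
  Connectivity phrased through edges only: it passes to subsets hanging on a cut vertex without
  any talk of paths.
\<close>

definition econn :: "'v set set \<Rightarrow> bool" where
  "econn F \<longleftrightarrow> (\<forall>A\<subseteq>F. A \<noteq> {} \<longrightarrow> A \<noteq> F \<longrightarrow> (\<exists>e\<in>A. \<exists>f\<in>F - A. e \<inter> f \<noteq> {}))"

lemma econnI:
  assumes "\<And>A. A \<subseteq> F \<Longrightarrow> A \<noteq> {} \<Longrightarrow> A \<noteq> F \<Longrightarrow> \<exists>e\<in>A. \<exists>f\<in>F - A. e \<inter> f \<noteq> {}"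
  shows "econn F"
  unfolding econn_def using assms by (intro allI impI)

lemma econnE:
  assumes "econn F" "A \<subseteq> F" "A \<noteq> {}" "A \<noteq> F"
  obtains e f where "e \<in> A" "f \<in> F" "f \<notin> A" "e \<inter> f \<noteq> {}"
proof -
  have "\<exists>e\<in>A. \<exists>f\<in>F - A. e \<inter> f \<noteq> {}" using assms unfolding econn_def by simp
  then show ?thesis using that by (elim bexE DiffE)
qed

lemma econn_empty [simp]: "econn {}"
  by (simp add: econn_def)

lemma econn_singleton [simp]: "econn {e}"
  by (rule econnI) (simp add: subset_singleton_iff)

lemma econn_Un:
  assumes "econn F" "econn F'" "e \<in> F" "f \<in> F'" "e \<inter> f \<noteq> {}"
  shows "econn (F \<union> F')"
proof (rule econnI)
  fix A assume A: "A \<subseteq> F \<union> F'" "A \<noteq> {}" "A \<noteq> F \<union> F'"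
  show "\<exists>e\<in>A. \<exists>f\<in>F \<union> F' - A. e \<inter> f \<noteq> {}"
  proof (cases "(A \<inter> F \<noteq> {} \<and> A \<inter> F \<noteq> F) \<or> (A \<inter> F' \<noteq> {} \<and> A \<inter> F' \<noteq> F')")
    case True
    then show ?thesis
    proof
      assume "A \<inter> F \<noteq> {} \<and> A \<inter> F \<noteq> F"
      then obtain x y where "x \<in> A \<inter> F" "y \<in> F" "y \<notin> A \<inter> F" "x \<inter> y \<noteq> {}"
        using econnE[OF assms(1), of "A \<inter> F"] by blast
      then show ?thesis by blast
    next
      assume "A \<inter> F' \<noteq> {} \<and> A \<inter> F' \<noteq> F'"
      then obtain x y where "x \<in> A \<inter> F'" "y \<in> F'" "y \<notin> A \<inter> F'" "x \<inter> y \<noteq> {}"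
        using econnE[OF assms(2), of "A \<inter> F'"] by blast
      then show ?thesis by blast
    qed
  next
    case False
    then have "(F \<subseteq> A \<or> A \<inter> F = {}) \<and> (F' \<subseteq> A \<or> A \<inter> F' = {})" by blast
    then have "(e \<in> A \<and> f \<in> F' - A) \<or> (f \<in> A \<and> e \<in> F - A)"
      using A assms(3,4) by blast
    then show ?thesis using assms(5) by blast
  qed
qed

lemma econn_insert:
  assumes "econn F" "e \<in> F" "e \<inter> f \<noteq> {}"
  shows "econn (insert f F)"
  using econn_Un[OF assms(1) econn_singleton assms(2) _ assms(3)] by simp

text \<open>A proper nonempty \<open>A\<close> contains \<open>B\<close>, misses \<open>B\<close> or
  splits it. If it splits \<open>B\<close>, two edges through \<open>v\<close> cross the boundary of
  \<open>A\<close>; otherwise some edge on the side without \<open>B\<close> meets an edge of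
  \<open>B\<close>.\<close>

lemma econn_hub:
  assumes "B \<subseteq> F" "\<And>e. e \<in> B \<Longrightarrow> v \<in> e" "\<And>e. e \<in> F \<Longrightarrow> \<exists>f\<in>B. e \<inter> f \<noteq> {}"
  shows "econn F"
proof (rule econnI)
  fix A assume A: "A \<subseteq> F" "A \<noteq> {}" "A \<noteq> F"
  consider "B \<subseteq> A" | "B \<inter> A = {}" | x y where "x \<in> B" "x \<in> A" "y \<in> B" "y \<notin> A" by blast
  then show "\<exists>e\<in>A. \<exists>f\<in>F - A. e \<inter> f \<noteq> {}"
  proof cases
    case 1
    obtain e where "e \<in> F - A" using A by blast
    then show ?thesis using 1 assms(3)[of e] by blast
  next
    case 2
    obtain e where "e \<in> A" using A by blast
    then show ?thesis using 2 assms(1) assms(3)[of e] A by blast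
  next
    case 3
    then have "x \<inter> y \<noteq> {}" using assms(2) by blast
    then show ?thesis using 3 assms(1) by blast
  qed
qed

lemma econn_image_iff:
  assumes "inj \<phi>"
  shows "econn ((`) \<phi> ` F) \<longleftrightarrow> econn F"
proof -
  have inj: "inj ((`) \<phi>)" using assms by (simp add: inj_on_image)
  have meet: "\<phi> ` e \<inter> \<phi> ` f \<noteq> {} \<longleftrightarrow> e \<inter> f \<noteq> {}" for e f
    using image_Int[OF assms, of e f] by (metis image_is_empty)
  show ?thesis
  proof
    assume F: "econn ((`) \<phi> ` F)"
    show "econn F"
    proof (rule econnI)
      fix A assume A: "A \<subseteq> F" "A \<noteq> {}" "A \<noteq> F"
      have "(`) \<phi> ` A \<noteq> (`) \<phi> ` F" using A(3) inj by (simp add: inj_image_eq_iff)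
      moreover have "(`) \<phi> ` A \<subseteq> (`) \<phi> ` F" "(`) \<phi> ` A \<noteq> {}" using A by (simp_all add: image_mono)
      ultimately obtain e f where ef: "e \<in> (`) \<phi> ` A" "f \<in> (`) \<phi> ` F" "f \<notin> (`) \<phi> ` A" "e \<inter> f \<noteq> {}"
        using econnE[OF F] by metis
      then obtain e' f' where "e = \<phi> ` e'" "e' \<in> A" "f = \<phi> ` f'" "f' \<in> F - A" by auto
      then show "\<exists>e\<in>A. \<exists>f\<in>F - A. e \<inter> f \<noteq> {}" using meet[of e' f'] ef(4) by auto
    qed
  next
    assume F: "econn F"
    show "econn ((`) \<phi> ` F)"
    proof (rule econnI)
      fix A assume A: "A \<subseteq> (`) \<phi> ` F" "A \<noteq> {}" "A \<noteq> (`) \<phi> ` F"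
      define A' where "A' = {e \<in> F. \<phi> ` e \<in> A}"
      have "(`) \<phi> ` A' = A" using A(1) by (auto simp: A'_def)
      then have "A' \<subseteq> F" "A' \<noteq> {}" "A' \<noteq> F" using A(2,3) by (auto simp: A'_def)
      then obtain e f where "e \<in> A'" "f \<in> F" "f \<notin> A'" "e \<inter> f \<noteq> {}"
        using econnE[OF F] by metis
      then have "\<phi> ` e \<in> A" "\<phi> ` f \<in> (`) \<phi> ` F - A" by (simp_all add: A'_def)
      moreover have "\<phi> ` e \<inter> \<phi> ` f \<noteq> {}" using meet[of e f] \<open>e \<inter> f \<noteq> {}\<close> by simp
      ultimately show "\<exists>e\<in>A. \<exists>f\<in>(`) \<phi> ` F - A. e \<inter> f \<noteq> {}" by (intro bexI)
    qed
  qed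
qed

text \<open>The part of \<open>F\<close> in \<open>X\<close> touches the rest of \<open>F\<close>
  only in \<open>v\<close>. If it fell into two pieces without common vertices, at most one of them
  could contain an edge through \<open>v\<close>, and the other piece would be separated within
  \<open>F\<close> as well.\<close>

lemma econn_branch:
  assumes "econn F" and cut: "\<And>e f. e \<in> F \<Longrightarrow> e \<in> X \<Longrightarrow> f \<in> F \<Longrightarrow> f \<notin> X \<Longrightarrow> e \<inter> f \<subseteq> {v}"
  shows "econn (F \<inter> X)"
proof (rule econnI, rule ccontr)
  fix A assume A: "A \<subseteq> F \<inter> X" "A \<noteq> {}" "A \<noteq> F \<inter> X"
    and no: "\<not> (\<exists>e\<in>A. \<exists>f\<in>F \<inter> X - A. e \<inter> f \<noteq> {})"
  have aux: False if B: "B \<subseteq> F \<inter> X" "B \<noteq> {}" "B \<noteq> F \<inter> X" and v: "\<forall>e\<in>B. v \<notin> e"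
    and noB: "\<forall>e\<in>B. \<forall>f\<in>F \<inter> X - B. e \<inter> f = {}" for B
  proof -
    obtain e f where ef: "e \<in> B" "f \<in> F" "f \<notin> B" "e \<inter> f \<noteq> {}"
      using econnE[OF assms(1), of B] B by blast
    then have "f \<notin> X" using noB by blast
    then have "v \<in> e" using cut[of e f] ef B by blast
    then show False using v ef by blast
  qed
  show False
  proof (cases "\<forall>e\<in>A. v \<notin> e")
    case True
    then show ?thesis using aux[of A] A no by blast
  next
    case False
    then have "\<forall>e\<in>F \<inter> X - A. v \<notin> e" using no by blast
    then show ?thesis using aux[of "F \<inter> X - A"] A no by blast
  qed
qed

lemma edge_of_two_vertices:
  assumes "card e = 2" "x \<in> e" "y \<in> e" "x \<noteq> y"
  shows "e = {x, y}"
  using assms by (auto simp: card_2_iff)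

text \<open>A path cannot leave the union of a set of edges that no other edge meets. Conversely,
  the edges meeting the set reachable from \<open>u\<close> are such a set, because an edge is
  determined by its two endpoints.\<close>

lemma connected_graph_edge_induced_iff:
  assumes two: "\<And>e. e \<in> F \<Longrightarrow> card e = 2"
  shows "connected_graph (edge_induced F) \<longleftrightarrow> econn F"
proof
  assume conn: "connected_graph (edge_induced F)"
  show "econn F"
  proof (rule econnI, rule ccontr)
    fix A assume A: "A \<subseteq> F" "A \<noteq> {}" "A \<noteq> F" and no: "\<not> (\<exists>e\<in>A. \<exists>f\<in>F - A. e \<inter> f \<noteq> {})"
    obtain e f where ef: "e \<in> A" "f \<in> F - A" using A by blast
    have "e \<noteq> {}" "f \<noteq> {}" using two[of e] two[of f] A ef by auto
    then obtain u v where uv: "u \<in> e" "v \<in> f" by blast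
    have "(u, v) \<in> (adj (edge_induced F))\<^sup>*"
      using conn uv ef A unfolding connected_graph_def edge_induced_def by auto
    then have "v \<in> \<Union>A"
    proof (induction rule: rtrancl_induct)
      case base
      then show ?case using uv ef by blast
    next
      case (step y z)
      then have yz: "{y, z} \<in> F" by (auto simp: adj_def edge_induced_def)
      obtain e' where "e' \<in> A" "y \<in> e'" using step by blast
      then have "{y, z} \<in> A" using no yz by (metis DiffI IntI empty_iff insertI1)
      then show ?case by blast
    qed
    then obtain e' where "e' \<in> A" "v \<in> e'" by blast
    then show False using no uv ef(2) by (metis IntI empty_iff)
  qed
next
  assume F: "econn F"
  show "connected_graph (edge_induced F)"
    unfolding connected_graph_def
  proof (intro ballI)
    fix u v assume u: "u \<in> verts (edge_induced F)" and v: "v \<in> verts (edge_induced F)"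
    define R where "R = {x. (u, x) \<in> (adj (edge_induced F))\<^sup>*}"
    have R: "y \<in> R" if "e \<in> F" "x \<in> e" "y \<in> e" "x \<in> R" for e x y
    proof (cases "x = y")
      case False
      then have "{x, y} \<in> F" using edge_of_two_vertices[of e x y] two that by blast
      then have "(x, y) \<in> adj (edge_induced F)" by (simp add: adj_def edge_induced_def)
      then show ?thesis using \<open>x \<in> R\<close> unfolding R_def by (auto intro: rtrancl_into_rtrancl)
    qed (use that in auto)
    define A where "A = {e \<in> F. e \<inter> R \<noteq> {}}"
    have "u \<in> R" by (simp add: R_def)
    then have "A \<noteq> {}" using u by (auto simp: A_def edge_induced_def)
    have "A = F"
    proof (rule ccontr)
      assume "A \<noteq> F"
      then obtain e f where ef: "e \<in> A" "f \<in> F" "f \<notin> A" "e \<inter> f \<noteq> {}"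
        using econnE[OF F, of A] \<open>A \<noteq> {}\<close> by (auto simp: A_def)
      then obtain x y where "x \<in> e" "x \<in> f" "y \<in> e" "y \<in> R" "e \<in> F" by (auto simp: A_def)
      then have "x \<in> R" using R by blast
      then show False using ef \<open>x \<in> f\<close> by (auto simp: A_def)
    qed
    obtain f where "v \<in> f" "f \<in> F" using v by (auto simp: edge_induced_def)
    then obtain x where "x \<in> f" "x \<in> R" using \<open>A = F\<close> by (auto simp: A_def)
    then have "v \<in> R" using R \<open>v \<in> f\<close> \<open>f \<in> F\<close> by blast
    then show "(u, v) \<in> (adj (edge_induced F))\<^sup>*" by (simp add: R_def)
  qed
qed

section \<open>Part sizes of connected colourings\<close>

definition colour_class :: "'v set set \<Rightarrow> ('v set \<Rightarrow> nat) \<Rightarrow> nat \<Rightarrow> 'v set set" where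
  "colour_class E c z = {e \<in> E. c e = z}"

text \<open>
  The size of the part of the root edge \<^term>\<open>r\<close> is left out, being determined by the others; it
  changes when \<^term>\<open>E\<close> is embedded into a larger graph through \<^term>\<open>r\<close>, whereas the others do not.
\<close>

definition other_sizes :: "'v set set \<Rightarrow> 'v set \<Rightarrow> ('v set \<Rightarrow> nat) \<Rightarrow> nat multiset" where
  "other_sizes E r c = image_mset (\<lambda>z. card (colour_class E c z)) (mset_set (c ` E - {c r}))"

text \<open>The condition ranges over all naturals \<open>z\<close>: colours that do not occur have
  the empty class, which is connected by convention.\<close>

definition sizes :: "'v set set \<Rightarrow> 'v set \<Rightarrow> nat multiset set" where
  "sizes E r = {other_sizes E r c |c. \<forall>z. econn (colour_class E c z)}"

text \<open>Both branches below a vertex thus have the same set of size multisets, and the recursion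
  runs over a single sequence of sets.\<close>

lemma sizes_image:
  assumes "inj \<phi>"
  shows "sizes ((`) \<phi> ` E) (\<phi> ` r) = sizes E r"
proof -
  have inj: "inj ((`) \<phi>)" using assms by (simp add: inj_on_image)
  have cls: "colour_class ((`) \<phi> ` E) c z = (`) \<phi> ` colour_class E (c \<circ> (`) \<phi>) z" for c z
    by (auto simp: colour_class_def)
  have conn: "econn (colour_class ((`) \<phi> ` E) c z) \<longleftrightarrow> econn (colour_class E (c \<circ> (`) \<phi>) z)" for c z
    unfolding cls by (rule econn_image_iff[OF assms])
  have card: "card (colour_class ((`) \<phi> ` E) c z) = card (colour_class E (c \<circ> (`) \<phi>) z)" for c z
    unfolding cls by (rule card_image) (rule inj_on_subset[OF inj], simp)
  have other: "other_sizes ((`) \<phi> ` E) (\<phi> ` r) c = other_sizes E r (c \<circ> (`) \<phi>)" for c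
    by (simp add: other_sizes_def card image_comp)
  show ?thesis
  proof (intro equalityI subsetI)
    fix \<mu> assume "\<mu> \<in> sizes ((`) \<phi> ` E) (\<phi> ` r)"
    then show "\<mu> \<in> sizes E r" unfolding sizes_def using conn other by auto
  next
    fix \<mu> assume "\<mu> \<in> sizes E r"
    then obtain c where c: "\<mu> = other_sizes E r c" "\<forall>z. econn (colour_class E c z)"
      by (auto simp: sizes_def)
    define c' where "c' = c \<circ> inv ((`) \<phi>)"
    have "c' \<circ> (`) \<phi> = c" using inj by (simp add: c'_def fun_eq_iff)
    then have "\<mu> = other_sizes ((`) \<phi> ` E) (\<phi> ` r) c'" "\<forall>z. econn (colour_class ((`) \<phi> ` E) c' z)"
      using c other[of c'] conn[of c'] by auto
    then show "\<mu> \<in> sizes ((`) \<phi> ` E) (\<phi> ` r)" unfolding sizes_def by blast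
  qed
qed

lemma card_eq_sum_colour_classes:
  assumes "finite E"
  shows "card E = (\<Sum>z\<in>c ` E. card (colour_class E c z))"
proof -
  have "card E = (\<Sum>e\<in>E. 1)" by simp
  also have "\<dots> = (\<Sum>z\<in>c ` E. \<Sum>e\<in>{e \<in> E. c e = z}. 1)"
    by (rule sum.image_gen[OF assms])
  also have "\<dots> = (\<Sum>z\<in>c ` E. card (colour_class E c z))"
    by (simp add: colour_class_def)
  finally show ?thesis .
qed

text \<open>The omitted size can be recovered from the total, so the truncated differences in the
  recursion below are exact.\<close>

lemma card_root_class:
  assumes "finite E" "r \<in> E"
  shows "card E = card (colour_class E c (c r)) + \<Sum>\<^sub># (other_sizes E r c)"
proof -
  have "\<Sum>\<^sub># (other_sizes E r c) = (\<Sum>z\<in>c ` E - {c r}. card (colour_class E c z))"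
    unfolding other_sizes_def by (rule sum_unfold_sum_mset[symmetric])
  then show ?thesis
    using sum.remove[of "c ` E" "c r" "\<lambda>z. card (colour_class E c z)"] assms
      card_eq_sum_colour_classes[OF assms(1), of c] by simp
qed

text \<open>Two branches \<^term>\<open>X\<close>, \<^term>\<open>Y\<close> and an edge \<^term>\<open>r\<close> glued together at the vertex \<^term>\<open>p\<close>.\<close>

locale junction =
  fixes E X Y :: "'v set set" and r rx ry :: "'v set" and p :: 'v
  assumes edges_eq: "E = insert r (X \<union> Y)"
    and finite_X: "finite X" and finite_Y: "finite Y"
    and r_notin: "r \<notin> X" "r \<notin> Y" and disjoint: "X \<inter> Y = {}"
    and rx: "rx \<in> X" and ry: "ry \<in> Y"
    and p_in: "p \<in> r" "p \<in> rx" "p \<in> ry"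
    and only_rx: "\<And>e. e \<in> X \<Longrightarrow> p \<in> e \<Longrightarrow> e = rx"
    and only_ry: "\<And>e. e \<in> Y \<Longrightarrow> p \<in> e \<Longrightarrow> e = ry"
    and meet_XY: "\<And>e f. e \<in> X \<Longrightarrow> f \<in> Y \<Longrightarrow> e \<inter> f \<subseteq> {p}"
    and meet_Xr: "\<And>e. e \<in> X \<Longrightarrow> e \<inter> r \<subseteq> {p}"
    and meet_Yr: "\<And>e. e \<in> Y \<Longrightarrow> e \<inter> r \<subseteq> {p}"
begin

lemma swap: "junction E Y X r ry rx p"
proof (rule junction.intro)
  show "E = insert r (Y \<union> X)" using edges_eq by (simp add: Un_commute)
  show "Y \<inter> X = {}" using disjoint by (simp add: Int_commute)
  show "e \<inter> f \<subseteq> {p}" if "e \<in> Y" "f \<in> X" for e f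
    using meet_XY[OF that(2,1)] by (simp add: Int_commute)
qed (rule finite_Y finite_X r_notin rx ry p_in only_rx only_ry meet_Xr meet_Yr; assumption)+

lemma meet_outside:
  assumes "e \<in> X" "f \<in> E" "f \<notin> X"
  shows "e \<inter> f \<subseteq> {p}"
proof -
  have "f = r \<or> f \<in> Y" using assms edges_eq by blast
  then show ?thesis using meet_XY[of e f] meet_Xr[of e] assms(1) by blast
qed

lemma econn_class_X:
  assumes "econn (colour_class E c z)"
  shows "econn (colour_class X c z)"
proof -
  have "econn (colour_class E c z \<inter> X)"
    using assms by (rule econn_branch[where v = p]) (rule meet_outside, auto simp: colour_class_def)
  moreover have "colour_class E c z \<inter> X = colour_class X c z"
    using edges_eq by (auto simp: colour_class_def)
  ultimately show ?thesis by simp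
qed

text \<open>Only \<^term>\<open>rx\<close> leads out of \<^term>\<open>X\<close>, so a connected class avoiding it stays inside.\<close>

lemma class_within_X:
  assumes conn: "econn (colour_class E c z)" and z: "z \<in> c ` X - {c rx}"
  shows "colour_class E c z = colour_class X c z"
proof (rule ccontr)
  assume neq: "colour_class E c z \<noteq> colour_class X c z"
  have "colour_class X c z \<subseteq> colour_class E c z" using edges_eq by (auto simp: colour_class_def)
  moreover have "colour_class X c z \<noteq> {}" using z by (auto simp: colour_class_def)
  ultimately obtain e f where ef: "e \<in> colour_class X c z" "f \<in> colour_class E c z"
    "f \<notin> colour_class X c z" "e \<inter> f \<noteq> {}"
    using econnE[OF conn] neq by metis
  then have "e \<inter> f \<subseteq> {p}" by (intro meet_outside) (auto simp: colour_class_def)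
  then have "p \<in> e" using ef(4) by auto
  then have "e = rx" using only_rx ef(1) by (auto simp: colour_class_def)
  then show False using ef(1) z by (auto simp: colour_class_def)
qed

lemma colour_X_foreign:
  assumes "econn (colour_class E c z)" "z \<in> c ` X - {c rx}"
  shows "z \<noteq> c r" "z \<notin> c ` Y"
proof -
  note eq = class_within_X[OF assms]
  show "z \<noteq> c r" using eq r_notin edges_eq by (auto simp: colour_class_def)
  show "z \<notin> c ` Y"
  proof
    assume "z \<in> c ` Y"
    then obtain f where "f \<in> Y" "c f = z" by auto
    then have "f \<in> colour_class E c z" using edges_eq by (auto simp: colour_class_def)
    then show False using eq disjoint \<open>f \<in> Y\<close> by (auto simp: colour_class_def)
  qed
qed

text \<open>Parts avoiding \<open>p\<close> lie in one branch and keep their sizes. The five cases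
  tell what happens at \<open>p\<close> to the root parts of \<open>X\<close> and \<open>Y\<close>:
  both join the part of \<open>r\<close>; only the one of \<open>Y\<close> does; only the one of
  \<open>X\<close> does; they join each other but not \<open>r\<close>; or all three stay
  separate.\<close>

lemma sizes_split:
  assumes "\<mu> \<in> sizes E r"
  shows "\<exists>\<mu>1\<in>sizes X rx. \<exists>\<mu>2\<in>sizes Y ry.
    \<mu> = \<mu>1 + \<mu>2 \<or>
    \<mu> = \<mu>1 + \<mu>2 + {#card X - \<Sum>\<^sub># \<mu>1#} \<or>
    \<mu> = \<mu>1 + \<mu>2 + {#card Y - \<Sum>\<^sub># \<mu>2#} \<or>
    \<mu> = \<mu>1 + \<mu>2 + {#(card X - \<Sum>\<^sub># \<mu>1) + (card Y - \<Sum>\<^sub># \<mu>2)#} \<or>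
    \<mu> = \<mu>1 + \<mu>2 + {#card X - \<Sum>\<^sub># \<mu>1, card Y - \<Sum>\<^sub># \<mu>2#}"
proof -
  interpret swap: junction E Y X r ry rx p by (rule swap)
  obtain c where \<mu>: "\<mu> = other_sizes E r c" and conn: "\<And>z. econn (colour_class E c z)"
    using assms by (auto simp: sizes_def)
  define U where "U = c ` X - {c rx}"
  define W where "W = c ` Y - {c ry}"
  \<comment> \<open>The colours at \<open>p\<close> other than that of \<open>r\<close>: the only
    ones that are counted in \<open>E\<close> but in neither branch.\<close>
  define V where "V = {c rx, c ry} - {c r}"
  define s where "s z = card (colour_class E c z)" for z
  have fin: "finite U" "finite W" "finite V"
    using finite_X finite_Y by (simp_all add: U_def W_def V_def)
  have U: "s z = card (colour_class X c z)" "z \<noteq> c r" "z \<notin> c ` Y" if "z \<in> U" for z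
    using class_within_X[OF conn] colour_X_foreign[OF conn] that by (simp_all add: U_def s_def)
  have W: "s z = card (colour_class Y c z)" "z \<noteq> c r" "z \<notin> c ` X" if "z \<in> W" for z
    using swap.class_within_X[OF conn] swap.colour_X_foreign[OF conn] that
    by (simp_all add: W_def s_def)
  have "c ` E - {c r} = U \<union> W \<union> V"
  proof
    show "c ` E - {c r} \<subseteq> U \<union> W \<union> V" by (auto simp: edges_eq U_def W_def V_def)
    show "U \<union> W \<union> V \<subseteq> c ` E - {c r}"
      using U(2) W(2) rx ry by (auto simp: edges_eq U_def W_def V_def)
  qed
  moreover have UW: "U \<inter> W = {}" using U(3) by (auto simp: W_def)
  moreover have "(U \<union> W) \<inter> V = {}" using U(3) W(3) rx ry by (auto simp: U_def W_def V_def)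
  ultimately have "mset_set (c ` E - {c r}) = mset_set U + mset_set W + mset_set V"
    using fin by (simp add: mset_set_Union)
  then have split: "\<mu> = image_mset s (mset_set U) + image_mset s (mset_set W) + image_mset s (mset_set V)"
    by (simp add: \<mu> other_sizes_def s_def[abs_def])
  define \<mu>1 where "\<mu>1 = other_sizes X rx c"
  define \<mu>2 where "\<mu>2 = other_sizes Y ry c"
  define a where "a = card X - \<Sum>\<^sub># \<mu>1"
  define b where "b = card Y - \<Sum>\<^sub># \<mu>2"
  have mem: "\<mu>1 \<in> sizes X rx" "\<mu>2 \<in> sizes Y ry"
    using econn_class_X[OF conn] swap.econn_class_X[OF conn] by (auto simp: sizes_def \<mu>1_def \<mu>2_def)
  have "image_mset s (mset_set U) = \<mu>1"
    unfolding \<mu>1_def other_sizes_def U_def[symmetric] using U(1) fin by (intro image_mset_cong) simp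
  moreover have "image_mset s (mset_set W) = \<mu>2"
    unfolding \<mu>2_def other_sizes_def W_def[symmetric] using W(1) fin by (intro image_mset_cong) simp
  ultimately have \<mu>_eq: "\<mu> = \<mu>1 + \<mu>2 + image_mset s (mset_set V)" using split by simp
  have sX: "card (colour_class X c (c rx)) = a"
    using card_root_class[OF finite_X rx, of c] by (simp add: \<mu>1_def a_def)
  have sY: "card (colour_class Y c (c ry)) = b"
    using card_root_class[OF finite_Y ry, of c] by (simp add: \<mu>2_def b_def)
  have s: "s z = card (colour_class X c z) + card (colour_class Y c z)" if "z \<noteq> c r" for z
  proof -
    have "colour_class E c z = colour_class X c z \<union> colour_class Y c z"
      using that by (auto simp: colour_class_def edges_eq)
    moreover have "colour_class X c z \<inter> colour_class Y c z = {}"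
      using disjoint by (auto simp: colour_class_def)
    ultimately show ?thesis using finite_X finite_Y
      by (simp add: s_def card_Un_disjoint colour_class_def)
  qed
  \<comment> \<open>A colour of \<open>X\<close> other than \<open>c rx\<close> does not occur in
    \<open>Y\<close>. As \<open>c ry\<close> does occur there, it is missing from \<open>X\<close>
    unless the two colours at \<open>p\<close> agree.\<close>
  have X0: "colour_class X c (c ry) = {}" if "c rx \<noteq> c ry"
  proof -
    have "c ry \<notin> c ` X" using U(3)[of "c ry"] ry that by (metis DiffI U_def imageI singletonD)
    then show ?thesis by (auto simp: colour_class_def image_iff)
  qed
  have Y0: "colour_class Y c (c rx) = {}" if "c rx \<noteq> c ry"
  proof -
    have "c rx \<notin> c ` Y" using W(3)[of "c rx"] rx that by (metis DiffI W_def imageI singletonD)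
    then show ?thesis by (auto simp: colour_class_def image_iff)
  qed
  consider "V = {}" | "V = {c rx}" "c rx \<noteq> c r" "c rx \<noteq> c ry" | "V = {c ry}" "c ry \<noteq> c r" "c rx \<noteq> c ry"
    | "V = {c rx}" "c rx \<noteq> c r" "c rx = c ry" | "V = {c rx, c ry}" "c rx \<noteq> c r" "c ry \<noteq> c r" "c rx \<noteq> c ry"
    unfolding V_def
    by (cases "c rx = c r"; cases "c ry = c r"; cases "c rx = c ry") (simp_all add: insert_Diff_if)
  then have "image_mset s (mset_set V) = {#} \<or> image_mset s (mset_set V) = {#a#} \<or>
    image_mset s (mset_set V) = {#b#} \<or> image_mset s (mset_set V) = {#a + b#} \<or>
    image_mset s (mset_set V) = {#a, b#}"
  proof cases
    case 2
    then show ?thesis using s[of "c rx"] sX Y0 by simp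
  next
    case 3
    then show ?thesis using s[of "c ry"] sY X0 by simp
  next
    case 4
    then show ?thesis using s[of "c rx"] sX sY by simp
  next
    case 5
    then show ?thesis using s[of "c rx"] s[of "c ry"] sX sY X0 Y0 by simp
  qed simp
  then have "\<mu> = \<mu>1 + \<mu>2 \<or> \<mu> = \<mu>1 + \<mu>2 + {#a#} \<or> \<mu> = \<mu>1 + \<mu>2 + {#b#} \<or>
    \<mu> = \<mu>1 + \<mu>2 + {#a + b#} \<or> \<mu> = \<mu>1 + \<mu>2 + {#a, b#}"
    unfolding \<mu>_eq by (elim disjE) simp_all
  then show ?thesis unfolding a_def b_def by (intro bexI[OF _ mem(1)] bexI[OF _ mem(2)])
qed

text \<open>\<open>Y\<close> stays in one piece and either joins the root part of \<open>X\<close>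
  through \<open>r\<close>, or becomes a part of its own under a fresh colour while \<open>r\<close>
  alone joins that root part.\<close>

lemma sizes_extend:
  assumes \<mu>: "\<mu> \<in> sizes X rx" and Y: "econn Y"
  shows "\<mu> \<in> sizes E r" and "add_mset (card Y) \<mu> \<in> sizes E r"
proof -
  obtain c where c: "\<mu> = other_sizes X rx c" "\<And>z. econn (colour_class X c z)"
    using \<mu> by (auto simp: sizes_def)
  have root: "econn (insert r (colour_class X c (c rx)))"
    using c(2) rx p_in by (intro econn_insert[of _ rx]) (auto simp: colour_class_def)
  have img: "image_mset (\<lambda>z. card (colour_class E d z)) (mset_set (c ` X - {c rx})) = \<mu>"
    if "\<And>z. z \<in> c ` X - {c rx} \<Longrightarrow> colour_class E d z = colour_class X c z" for d
    unfolding c(1) other_sizes_def using that finite_X by (intro image_mset_cong) simp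
  show "\<mu> \<in> sizes E r"
  proof -
    define d where "d e = (if e \<in> X then c e else c rx)" for e
    have "colour_class E d z = colour_class X c z" if "z \<noteq> c rx" for z
      using that r_notin by (auto simp: colour_class_def d_def edges_eq)
    moreover have "colour_class E d (c rx) = insert r (colour_class X c (c rx)) \<union> Y"
      using disjoint r_notin by (auto simp: colour_class_def d_def edges_eq)
    moreover have "econn (insert r (colour_class X c (c rx)) \<union> Y)"
      using p_in ry by (intro econn_Un[OF root Y, of r ry]) auto
    ultimately have "econn (colour_class E d z)" for z using c(2) by (cases "z = c rx") auto
    moreover have "d ` E - {d r} = c ` X - {c rx}"
      using r_notin disjoint by (auto simp: d_def edges_eq)
    then have "other_sizes E r d = \<mu>"
      unfolding other_sizes_def using img[of d] \<open>\<And>z. z \<noteq> c rx \<Longrightarrow> colour_class E d z = colour_class X c z\<close>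
      by simp
    ultimately show ?thesis by (auto simp: sizes_def)
  qed
  show "add_mset (card Y) \<mu> \<in> sizes E r"
  proof -
    obtain w where w: "w \<notin> c ` X" using finite_X ex_new_if_finite[OF infinite_UNIV_nat] by blast
    then have "w \<noteq> c rx" using rx by auto
    define d where "d e = (if e \<in> X then c e else if e = r then c rx else w)" for e
    have X: "colour_class E d z = colour_class X c z" if "z \<noteq> c rx" "z \<noteq> w" for z
      using that r_notin by (auto simp: colour_class_def d_def edges_eq)
    moreover have "colour_class E d (c rx) = insert r (colour_class X c (c rx))"
      using disjoint r_notin \<open>w \<noteq> c rx\<close> by (auto simp: colour_class_def d_def edges_eq)
    moreover have cw: "colour_class E d w = Y"
      using disjoint r_notin \<open>w \<noteq> c rx\<close> w by (auto simp: colour_class_def d_def edges_eq)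
    ultimately have "econn (colour_class E d z)" for z
      using c(2)[of z] root Y by (cases "z = c rx"; cases "z = w") simp_all
    moreover have "d ` E - {d r} = insert w (c ` X - {c rx})"
      using r_notin disjoint ry \<open>w \<noteq> c rx\<close> by (auto simp: d_def edges_eq image_iff)
    then have "other_sizes E r d = add_mset (card Y) \<mu>"
      unfolding other_sizes_def using img[of d] X w cw finite_X by fastforce
    ultimately show ?thesis unfolding sizes_def by (intro CollectI exI[of _ d]) simp
  qed
qed

end

section \<open>Planted binary trees\<close>

text \<open>The last binary digit of a vertex above 1 tells its branch. With the free end sent to 1,
  the images of \<open>{0..n}\<close> under the two maps meet only in 1 and fill
  \<open>{1..2 * n + 1}\<close> without gaps, so the vertex sets remain intervals.\<close>

definition child_map :: "nat \<Rightarrow> nat \<Rightarrow> nat" where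
  "child_map t x = (if x = 0 then 1 else 2 * x + t)"

text \<open>
  The vertex 0 is the free end of an extra edge planted above the root 1; the subtrees of
  the two children then are copies of the previous planted graph, whose free ends are
  glued together at 1.
\<close>

primrec planted :: "nat set set \<Rightarrow> nat \<Rightarrow> nat set set" where
  "planted H 0 = insert {0, 1} H"
| "planted H (Suc i) = insert {0, 1}
     ((`) (child_map 0) ` planted H i \<union> (`) (child_map 1) ` planted H i)"

lemma inj_child_map: "t \<le> 1 \<Longrightarrow> inj (child_map t)"
proof (rule injI)
  fix x y assume "child_map t x = child_map t y"
  then show "x = y" unfolding child_map_def by (cases "x = 0"; cases "y = 0") simp_all
qed

definition edges_on :: "nat \<Rightarrow> nat set set" where
  "edges_on h = {e. e \<subseteq> {1..h} \<and> card e = 2}"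

lemma finite_edges_on: "finite (edges_on h)"
  unfolding edges_on_def by simp

lemma child_map_eq_1_iff: "t \<le> 1 \<Longrightarrow> child_map t x = 1 \<longleftrightarrow> x = 0"
  by (auto simp: child_map_def)

lemma child_map_pos: "child_map t x \<noteq> 0"
  by (auto simp: child_map_def)

lemma child_maps_meet: "child_map 0 x = child_map 1 y \<Longrightarrow> child_map 0 x = 1"
  by (cases "x = 0"; cases "y = 0") (simp_all add: child_map_def Suc_double_not_eq_double[symmetric] double_not_eq_Suc_double)

context
  fixes H :: "nat set set" and h :: nat
  assumes H: "H \<subseteq> edges_on h"
begin

lemma finite_planted: "finite (planted H i)"
  using finite_subset[OF H finite_edges_on] by (induction i) simp_all

lemma root_in_planted: "{0, 1} \<in> planted H i"
  by (cases i) auto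

lemma card_planted_edge: "e \<in> planted H i \<Longrightarrow> card e = 2"
proof (induction i arbitrary: e)
  case 0
  then show ?case using H by (auto simp: edges_on_def)
next
  case (Suc i)
  have "card (child_map t ` f) = card f" if "t \<le> 1" for t f
    by (rule card_image) (rule inj_on_subset[OF inj_child_map[OF that]], simp)
  then show ?case using Suc by auto
qed

lemma zero_in_planted_edge: "e \<in> planted H i \<Longrightarrow> 0 \<in> e \<Longrightarrow> e = {0, 1}"
proof (cases i)
  case 0
  have "e \<subseteq> {1..h}" if "e \<in> H" using that H unfolding edges_on_def by blast
  then have "0 \<notin> e" if "e \<in> H" using that by (metis atLeastAtMost_iff not_one_le_zero subsetD)
  then show "e \<in> planted H i \<Longrightarrow> 0 \<in> e \<Longrightarrow> e = {0, 1}" using 0 by auto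
next
  case (Suc j)
  have "0 \<notin> child_map t ` f" for t f using child_map_pos by (metis imageE)
  then show "e \<in> planted H i \<Longrightarrow> 0 \<in> e \<Longrightarrow> e = {0, 1}" using Suc by auto
qed

lemma junction_planted:
  "junction (planted H (Suc i)) ((`) (child_map 0) ` planted H i) ((`) (child_map 1) ` planted H i)
     {0, 1} (child_map 0 ` {0, 1}) (child_map 1 ` {0, 1}) 1"
proof -
  have zero: "0 \<notin> child_map t ` e" for t e using child_map_pos by (metis imageE)
  have one: "1 \<in> child_map t ` e \<longleftrightarrow> 0 \<in> e" if "t \<le> 1" for t e
    using child_map_eq_1_iff[OF that] by (metis image_iff)
  have meet: "child_map 0 ` e \<inter> child_map 1 ` f \<subseteq> {1}" for e f
    using child_maps_meet by fastforce
  \<comment> \<open>A common edge of both branches would be contained in \<open>{1}\<close>, but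
    edges have two endpoints.\<close>
  have distinct: "child_map 0 ` e \<noteq> child_map 1 ` f" if "e \<in> planted H i" for e f
  proof
    assume eq: "child_map 0 ` e = child_map 1 ` f"
    have "card (child_map 0 ` e) = 2"
      using card_planted_edge[OF that] card_image[OF inj_on_subset[OF inj_child_map[of 0]], of e]
      by simp
    moreover have "child_map 0 ` e \<subseteq> {1}" using meet[of e f] eq by blast
    then have "card (child_map 0 ` e) \<le> 1" using card_mono[of "{1::nat}" "child_map 0 ` e"] by simp
    ultimately show False by simp
  qed
  have root: "{0, 1} \<notin> (`) (child_map t) ` planted H i" for t
    using zero by (metis imageE insertI1)
  have only: "e = child_map t ` {0, 1}" if "t \<le> 1" "e \<in> (`) (child_map t) ` planted H i" "1 \<in> e" for t e
    using that one[of t] zero_in_planted_edge by (metis imageE)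
  have meet_root: "e \<inter> {0, 1} \<subseteq> {1}" if "e \<in> (`) (child_map t) ` planted H i" for e t
  proof -
    have "0 \<notin> e" using that zero by (metis imageE)
    then show ?thesis by blast
  qed
  have fin: "finite ((`) (child_map t) ` planted H i)" for t
    using finite_planted by simp
  have sub: "child_map t ` {0, 1} \<in> (`) (child_map t) ` planted H i" for t
    using root_in_planted by blast
  show ?thesis
  proof (rule junction.intro)
    show "e = child_map 0 ` {0, 1}" if "e \<in> (`) (child_map 0) ` planted H i" "1 \<in> e" for e
      using only[OF _ that] by simp
    show "e = child_map 1 ` {0, 1}" if "e \<in> (`) (child_map 1) ` planted H i" "1 \<in> e" for e
      using only[OF _ that] by simp
    show "e \<inter> f \<subseteq> {1}" if "e \<in> (`) (child_map 0) ` planted H i"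
      "f \<in> (`) (child_map 1) ` planted H i" for e f
      using that meet by (metis imageE)
    show "(`) (child_map 0) ` planted H i \<inter> (`) (child_map 1) ` planted H i = {}"
    proof (rule equals0I)
      fix e assume "e \<in> (`) (child_map 0) ` planted H i \<inter> (`) (child_map 1) ` planted H i"
      then show False using distinct by (elim IntE imageE) metis
    qed
    show "1 \<in> child_map 0 ` {0, 1}" "1 \<in> child_map 1 ` {0, 1}"
      by (simp_all add: child_map_def)
  qed (simp, fact fin, fact fin, fact root, fact root, fact sub, fact sub, simp, fact meet_root, fact meet_root)
qed

end

section \<open>Counting part sizes from above\<close>

text \<open>For \<open>Suc t\<close> parts, 1 accounts for the lowest level,
  \<open>(t + 1)^2\<close> generously for the \<open>t\<close> ways of splitting the number of parts
  in a plain sum, and \<open>4 * (t + 1)^2\<close> for the four ways of cutting at the junction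
  together with the numbers of parts in the branches. The square of \<open>count_const t\<close>
  comes from the two branches.\<close>

primrec count_const :: "nat \<Rightarrow> nat" where
  "count_const 0 = 1"
| "count_const (Suc t) = 1 + 5 * (t + 1)^2 * (count_const t)^2"

lemma count_const_pos: "1 \<le> count_const t"
  by (cases t) simp_all

lemma count_const_mono: "s \<le> t \<Longrightarrow> count_const s \<le> count_const t"
proof (induction t rule: dec_induct)
  case (step t)
  have "count_const t * 1 \<le> count_const t * ((t + 1)^2 * count_const t)"
    using count_const_pos[of t] by (intro mult_le_mono2) (simp add: Suc_le_eq)
  also have "\<dots> = (t + 1)^2 * (count_const t)^2" by (simp add: power2_eq_square algebra_simps)
  finally show ?case using step.IH by simp
qed simp

lemma card_multisets_le:
  "finite {\<mu>. set_mset \<mu> \<subseteq> {1..e} \<and> size \<mu> = t} \<and> card {\<mu>. set_mset \<mu> \<subseteq> {1..e::nat} \<and> size \<mu> = t} \<le> e ^ t"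
proof -
  let ?X = "{xs. set xs \<subseteq> {1..e} \<and> length xs = t}"
  have X: "finite ?X" "card ?X = e ^ t"
    using finite_lists_length_eq[of "{1..e}" t] card_lists_length_eq[of "{1..e}" t] by simp_all
  have sub: "{\<mu>. set_mset \<mu> \<subseteq> {1..e} \<and> size \<mu> = t} \<subseteq> mset ` ?X"
  proof
    fix \<mu> :: "nat multiset" assume \<mu>: "\<mu> \<in> {\<mu>. set_mset \<mu> \<subseteq> {1..e} \<and> size \<mu> = t}"
    obtain xs where xs: "mset xs = \<mu>" using ex_mset[of \<mu>] by blast
    then have "set xs = set_mset \<mu>" "length xs = size \<mu>" by auto
    then show "\<mu> \<in> mset ` ?X" using \<mu> xs by blast
  qed
  have "card {\<mu>. set_mset \<mu> \<subseteq> {1..e} \<and> size \<mu> = t} \<le> card (mset ` ?X)"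
    using sub X by (intro card_mono) auto
  then show ?thesis using sub X card_image_le[of ?X mset] finite_subset[OF sub] by simp
qed

text \<open>
  The point of the recursion is that the plain sum \<^term>\<open>\<mu>1 + \<mu>2\<close> with an empty summand stays
  inside the union over all levels, so the level only enters as a parameter
  when at least one new part is cut off.
\<close>

lemma multiset_recursion_bound:
  fixes M :: "nat \<Rightarrow> nat multiset set" and g :: "nat \<Rightarrow> nat \<Rightarrow> nat multiset \<Rightarrow> nat multiset \<Rightarrow> nat multiset"
    and e b :: nat
  assumes base: "\<And>\<mu>. \<mu> \<in> M 0 \<Longrightarrow> set_mset \<mu> \<subseteq> {1..e}"
    and step: "\<And>i \<mu>. \<mu> \<in> M (Suc i) \<Longrightarrow> \<exists>\<mu>1\<in>M i. \<exists>\<mu>2\<in>M i.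
      \<mu> = \<mu>1 + \<mu>2 \<or> (\<exists>j<4. \<mu> = \<mu>1 + \<mu>2 + g j i \<mu>1 \<mu>2)"
    and g: "\<And>j i \<mu>1 \<mu>2. g j i \<mu>1 \<mu>2 \<noteq> {#}"
  defines "L \<equiv> \<lambda>t. {\<mu>. size \<mu> = t \<and> (\<exists>i\<le>b. \<mu> \<in> M i)}"
  shows "finite (L t) \<and> card (L t) \<le> count_const t * (e + b + 1) ^ t"
proof (induction t rule: less_induct)
  case (less n)
  define D where "D = e + b + 1"
  have "D \<ge> 1" by (simp add: D_def)
  show ?case
  proof (cases n)
    case 0
    have sub: "L 0 \<subseteq> {{#}}" by (auto simp: L_def)
    then have "finite (L 0)" "card (L 0) \<le> card {{#} :: nat multiset}"
      using finite_subset[OF sub] card_mono[OF _ sub] by simp_all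
    then show ?thesis using 0 by simp
  next
    case (Suc t)
    let ?K = "count_const t"
    have fin: "finite (L s)" and bound: "card (L s) \<le> ?K * D ^ s" if "s \<le> t" for s
    proof -
      have IH: "finite (L s) \<and> card (L s) \<le> count_const s * D ^ s"
        using less[of s] that Suc by (simp add: D_def)
      then show "finite (L s)" by simp
      show "card (L s) \<le> ?K * D ^ s"
        using IH count_const_mono[OF that] mult_le_mono1[of "count_const s" ?K "D ^ s"] by linarith
    qed
    \<comment> \<open>Three sources: the lowest level, plain sums of two nonempty multisets, and
      sums with parts cut off at the junction. As \<open>L\<close> comprises all levels,
      \<open>T1\<close> needs no level; in \<open>T2\<close> the added sizes depend on the level
      \<open>i\<close>, whence the range \<open>{..<b}\<close>.\<close>
    define S0 where "S0 = {\<mu>. set_mset \<mu> \<subseteq> {1..e} \<and> size \<mu> = n}"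
    define T1 where "T1 s = (\<lambda>(x, y). x + y) ` (L s \<times> L (n - s))" for s
    define T2 where "T2 = (\<lambda>(j, s1, s2). (\<lambda>(i, x, y). x + y + g j i x y) ` ({..<b} \<times> L s1 \<times> L s2))"
    define J where "J = {(j, s1, s2). j < (4::nat) \<and> s1 \<le> t \<and> s2 \<le> t \<and> s1 + s2 \<le> t}"
    have cover: "\<mu> \<in> S0 \<union> (\<Union>s\<in>{1..t}. T1 s) \<union> (\<Union>q\<in>J. T2 q)"
      if "\<mu> \<in> M i" "i \<le> b" "size \<mu> = n" for \<mu> i
      using that
    proof (induction i arbitrary: \<mu>)
      case 0
      then show ?case using base by (auto simp: S0_def)
    next
      case (Suc i)
      obtain \<mu>1 \<mu>2 where m: "\<mu>1 \<in> M i" "\<mu>2 \<in> M i"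
        and alt: "\<mu> = \<mu>1 + \<mu>2 \<or> (\<exists>j<4. \<mu> = \<mu>1 + \<mu>2 + g j i \<mu>1 \<mu>2)"
        using step[OF Suc.prems(1)] by (elim bexE)
      have inL: "\<mu>1 \<in> L (size \<mu>1)" "\<mu>2 \<in> L (size \<mu>2)"
        using m Suc.prems(2) Suc_leD unfolding L_def by blast+
      from alt show ?case
      proof
        assume eq: "\<mu> = \<mu>1 + \<mu>2"
        then have size: "size \<mu>1 + size \<mu>2 = n" using Suc.prems(3) by simp
        consider "\<mu>1 = {#}" | "\<mu>2 = {#}" | "\<mu>1 \<noteq> {#}" "\<mu>2 \<noteq> {#}" by blast
        then show ?thesis
        proof cases
          case 1
          then show ?thesis using Suc.IH[of \<mu>2] m Suc.prems eq by simp
        next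
          case 2
          then show ?thesis using Suc.IH[of \<mu>1] m Suc.prems eq by simp
        next
          case 3
          then have "0 < size \<mu>1" "0 < size \<mu>2" by (simp_all add: nonempty_has_size)
          then have "size \<mu>1 \<in> {1..t}" "size \<mu>2 = n - size \<mu>1" using size \<open>n = Suc t\<close> by auto
          moreover have "\<mu> \<in> T1 (size \<mu>1)"
            unfolding T1_def using inL calculation(2) eq by (metis SigmaI case_prod_conv image_eqI)
          ultimately show ?thesis by blast
        qed
      next
        assume "\<exists>j<4. \<mu> = \<mu>1 + \<mu>2 + g j i \<mu>1 \<mu>2"
        then obtain j where j: "j < 4" "\<mu> = \<mu>1 + \<mu>2 + g j i \<mu>1 \<mu>2" by blast
        have "0 < size (g j i \<mu>1 \<mu>2)" using g by (simp add: nonempty_has_size)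
        then have "size \<mu>1 + size \<mu>2 \<le> t" using j(2) Suc.prems(3) \<open>n = Suc t\<close> by simp
        then have "(j, size \<mu>1, size \<mu>2) \<in> J" using j(1) by (simp add: J_def)
        moreover have "\<mu> \<in> T2 (j, size \<mu>1, size \<mu>2)"
          unfolding T2_def prod.case
          by (rule image_eqI[of _ _ "(i, \<mu>1, \<mu>2)"]) (use j(2) inL Suc.prems(2) in simp_all)
        ultimately show ?thesis by blast
      qed
    qed
    have L_sub: "L n \<subseteq> S0 \<union> (\<Union>s\<in>{1..t}. T1 s) \<union> (\<Union>q\<in>J. T2 q)"
    proof
      fix \<mu> assume "\<mu> \<in> L n"
      then obtain i where "i \<le> b" "\<mu> \<in> M i" "size \<mu> = n" unfolding L_def by blast
      then show "\<mu> \<in> S0 \<union> (\<Union>s\<in>{1..t}. T1 s) \<union> (\<Union>q\<in>J. T2 q)" using cover by blast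
    qed
    have S0: "finite S0" "card S0 \<le> D ^ n"
    proof -
      show "finite S0" using card_multisets_le[of e n] by (simp add: S0_def)
      have "card S0 \<le> e ^ n" using card_multisets_le[of e n] by (simp add: S0_def)
      also have "\<dots> \<le> D ^ n" by (rule power_mono) (simp_all add: D_def)
      finally show "card S0 \<le> D ^ n" .
    qed
    have T1: "finite (T1 s)" "card (T1 s) \<le> ?K\<^sup>2 * D ^ n" if "s \<in> {1..t}" for s
    proof -
      have s: "s \<le> t" "n - s \<le> t" "s + (n - s) = n" using that Suc by auto
      then have f: "finite (L s \<times> L (n - s))" using fin by blast
      then show "finite (T1 s)" by (simp add: T1_def)
      have "card (T1 s) \<le> card (L s) * card (L (n - s))"
        using card_image_le[OF f, of "\<lambda>(x, y). x + y"] by (simp add: T1_def card_cartesian_product)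
      also have "\<dots> \<le> (?K * D ^ s) * (?K * D ^ (n - s))"
        using bound s by (intro mult_le_mono) auto
      also have "\<dots> = ?K\<^sup>2 * D ^ (s + (n - s))" by (simp add: power_add power2_eq_square)
      finally show "card (T1 s) \<le> ?K\<^sup>2 * D ^ n" using s by simp
    qed
    have T2: "finite (T2 q) \<and> card (T2 q) \<le> ?K\<^sup>2 * D ^ n" if "q \<in> J" for q
    proof -
      obtain j s1 s2 where q: "q = (j, s1, s2)" by (cases q)
      then have s: "s1 \<le> t" "s2 \<le> t" "s1 + s2 \<le> t" using that by (auto simp: J_def)
      then have f: "finite ({..<b} \<times> L s1 \<times> L s2)" using fin by blast
      have "card (T2 q) \<le> b * (card (L s1) * card (L s2))"
        using card_image_le[OF f, of "\<lambda>(i, x, y). x + y + g j i x y"]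
        by (simp add: T2_def q card_cartesian_product)
      \<comment> \<open>At least one new part leaves \<open>s1 + s2 \<le> t\<close>, so the exponent
        has room for one more factor \<open>D\<close>, which pays for the choice of the
        level.\<close>
      also have "\<dots> \<le> D * ((?K * D ^ s1) * (?K * D ^ s2))"
        using bound s by (intro mult_le_mono) (auto simp: D_def)
      also have "\<dots> = ?K\<^sup>2 * D ^ Suc (s1 + s2)" by (simp add: power_add power2_eq_square)
      also have "\<dots> \<le> ?K\<^sup>2 * D ^ n"
        using s Suc \<open>D \<ge> 1\<close> by (intro mult_le_mono2 power_increasing) auto
      finally show ?thesis using f by (simp add: T2_def q)
    qed
    have J: "finite J" "card J \<le> 4 * (t + 1)^2"
    proof -
      have sub: "J \<subseteq> {..<4} \<times> {..t} \<times> {..t}" by (auto simp: J_def)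
      show "finite J" by (rule finite_subset[OF sub]) simp
      show "card J \<le> 4 * (t + 1)^2"
        using card_mono[OF _ sub] by (simp add: card_cartesian_product power2_eq_square)
    qed
    have c1: "card (\<Union>s\<in>{1..t}. T1 s) \<le> t * (?K\<^sup>2 * D ^ n)"
    proof -
      have "card (\<Union>s\<in>{1..t}. T1 s) \<le> (\<Sum>s\<in>{1..t}. card (T1 s))" by (rule card_UN_le) simp
      also have "\<dots> \<le> (\<Sum>s\<in>{1..t}. ?K\<^sup>2 * D ^ n)" using T1(2) by (intro sum_mono)
      finally show ?thesis by simp
    qed
    have c2: "card (\<Union>q\<in>J. T2 q) \<le> 4 * (t + 1)^2 * (?K\<^sup>2 * D ^ n)"
    proof -
      have "card (\<Union>q\<in>J. T2 q) \<le> (\<Sum>q\<in>J. card (T2 q))" by (rule card_UN_le) (rule J)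
      also have "\<dots> \<le> (\<Sum>q\<in>J. ?K\<^sup>2 * D ^ n)" using T2 by (intro sum_mono) blast
      also have "\<dots> = card J * (?K\<^sup>2 * D ^ n)" by simp
      also have "\<dots> \<le> 4 * (t + 1)^2 * (?K\<^sup>2 * D ^ n)" using J(2) by (rule mult_le_mono1)
      finally show ?thesis .
    qed
    have finU: "finite (S0 \<union> (\<Union>s\<in>{1..t}. T1 s) \<union> (\<Union>q\<in>J. T2 q))"
      using S0(1) T1(1) T2 J(1) by blast
    have "card (L n) \<le> card (S0 \<union> (\<Union>s\<in>{1..t}. T1 s) \<union> (\<Union>q\<in>J. T2 q))"
      by (rule card_mono[OF finU L_sub])
    also have "\<dots> \<le> card S0 + card (\<Union>s\<in>{1..t}. T1 s) + card (\<Union>q\<in>J. T2 q)"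
      by (meson add_le_mono1 card_Un_le le_trans)
    also have "\<dots> \<le> D ^ n + t * (?K\<^sup>2 * D ^ n) + 4 * (t + 1)^2 * (?K\<^sup>2 * D ^ n)"
      using S0(2) c1 c2 by (intro add_mono)
    also have "\<dots> \<le> D ^ n + (t + 1)^2 * (?K\<^sup>2 * D ^ n) + 4 * (t + 1)^2 * (?K\<^sup>2 * D ^ n)"
      by (intro add_mono mult_le_mono1) (simp_all add: power2_eq_square)
    also have "\<dots> = count_const n * D ^ n" using Suc by (simp add: algebra_simps)
    finally show ?thesis using finite_subset[OF L_sub finU] by (simp add: D_def)
  qed
qed

section \<open>Upper bound for planted trees\<close>

lemma set_mset_sizes_base:
  assumes H: "H \<subseteq> edges_on h" and \<mu>: "\<mu> \<in> sizes (planted H 0) {0, 1}"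
  shows "set_mset \<mu> \<subseteq> {1..card H}"
proof -
  obtain c where c: "\<mu> = other_sizes (planted H 0) {0, 1} c" using \<mu> by (auto simp: sizes_def)
  have fin: "finite H" using finite_subset[OF H finite_edges_on] .
  have "card (colour_class (planted H 0) c z) \<in> {1..card H}"
    if "z \<in> c ` planted H 0 - {c {0, 1}}" for z
  proof -
    have "colour_class (planted H 0) c z \<subseteq> H" "colour_class (planted H 0) c z \<noteq> {}"
      using that by (auto simp: colour_class_def)
    then show ?thesis using fin card_mono[of H] finite_subset[of _ H]
      by (simp add: Suc_le_eq card_gt_0_iff)
  qed
  moreover have "finite (c ` planted H 0 - {c {0, 1}})" using fin by simp
  ultimately show ?thesis unfolding c other_sizes_def by fastforce
qed

lemma card_branch:
  assumes "t \<le> 1"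
  shows "card ((`) (child_map t) ` planted H i) = card (planted H i)"
proof (rule card_image)
  have "inj ((`) (child_map t))" using inj_child_map[OF assms] by (simp add: inj_on_image)
  then show "inj_on ((`) (child_map t)) (planted H i)" by (rule inj_on_subset) simp
qed

text \<open>The four cutting patterns are listed by an index because the counting lemma wants the
  added sizes as a function of the index, the level and the two multisets.\<close>

lemma sizes_planted_Suc:
  assumes H: "H \<subseteq> edges_on h"
  shows "\<mu> \<in> sizes (planted H (Suc i)) {0, 1} \<Longrightarrow>
    \<exists>\<mu>1\<in>sizes (planted H i) {0, 1}. \<exists>\<mu>2\<in>sizes (planted H i) {0, 1}.
      \<mu> = \<mu>1 + \<mu>2 \<or>
      (\<exists>j<4. \<mu> = \<mu>1 + \<mu>2 +
        [{#card (planted H i) - \<Sum>\<^sub># \<mu>1#}, {#card (planted H i) - \<Sum>\<^sub># \<mu>2#},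
         {#(card (planted H i) - \<Sum>\<^sub># \<mu>1) + (card (planted H i) - \<Sum>\<^sub># \<mu>2)#},
         {#card (planted H i) - \<Sum>\<^sub># \<mu>1, card (planted H i) - \<Sum>\<^sub># \<mu>2#}] ! j)"
proof -
  assume \<mu>: "\<mu> \<in> sizes (planted H (Suc i)) {0, 1}"
  note card = card_branch[where H = H and i = i]
  have sz: "sizes ((`) (child_map t) ` planted H i) (child_map t ` {0, 1}) = sizes (planted H i) {0, 1}"
    if "t \<le> 1" for t by (rule sizes_image[OF inj_child_map[OF that]])
  note split = junction.sizes_split[OF junction_planted[OF H] \<mu>, unfolded sz[OF zero_le] sz[OF order_refl]
      card[OF zero_le] card[OF order_refl]]
  have list: "(\<exists>j<4. \<mu> = \<nu> + [a, b, c, d] ! j) \<longleftrightarrow>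
      \<mu> = \<nu> + a \<or> \<mu> = \<nu> + b \<or> \<mu> = \<nu> + c \<or> \<mu> = \<nu> + d"
    for \<nu> a b c d :: "nat multiset"
    by (simp add: numeral_eq_Suc Ex_less_Suc disj_ac)
  show ?thesis unfolding list by (rule split)
qed

lemma card_sizes_planted_le:
  assumes H: "H \<subseteq> edges_on h"
  shows "finite {\<mu> \<in> sizes (planted H b) {0, 1}. size \<mu> = t} \<and>
    card {\<mu> \<in> sizes (planted H b) {0, 1}. size \<mu> = t} \<le> count_const t * (card H + b + 1) ^ t"
proof -
  \<comment> \<open>The default \<open>{#0#}\<close> only serves to make the added multiset nonempty
    for every \<open>j\<close>.\<close>
  define g where "g j i \<mu>1 \<mu>2 = (if j < 4 then
        [{#card (planted H i) - \<Sum>\<^sub># \<mu>1#}, {#card (planted H i) - \<Sum>\<^sub># \<mu>2#},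
         {#(card (planted H i) - \<Sum>\<^sub># \<mu>1) + (card (planted H i) - \<Sum>\<^sub># \<mu>2)#},
         {#card (planted H i) - \<Sum>\<^sub># \<mu>1, card (planted H i) - \<Sum>\<^sub># \<mu>2#}] ! j else {#0#})"
    for j i \<mu>1 \<mu>2
  let ?L = "{\<mu>. size \<mu> = t \<and> (\<exists>i\<le>b. \<mu> \<in> sizes (planted H i) {0, 1})}"
  have "finite ?L \<and> card ?L \<le> count_const t * (card H + b + 1) ^ t"
  proof (rule multiset_recursion_bound[where g = g])
    show "\<mu> \<in> sizes (planted H 0) {0, 1} \<Longrightarrow> set_mset \<mu> \<subseteq> {1..card H}" for \<mu>
      by (rule set_mset_sizes_base[OF H])
    show "\<exists>\<mu>1\<in>sizes (planted H i) {0, 1}. \<exists>\<mu>2\<in>sizes (planted H i) {0, 1}.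
      \<mu> = \<mu>1 + \<mu>2 \<or> (\<exists>j<4. \<mu> = \<mu>1 + \<mu>2 + g j i \<mu>1 \<mu>2)"
      if "\<mu> \<in> sizes (planted H (Suc i)) {0, 1}" for i \<mu>
      using sizes_planted_Suc[OF H that] by (simp only: g_def cong: conj_cong) simp
    show "g j i \<mu>1 \<mu>2 \<noteq> {#}" for j i \<mu>1 \<mu>2
      by (simp add: g_def nth_Cons split: nat.split)
  qed
  moreover have "{\<mu> \<in> sizes (planted H b) {0, 1}. size \<mu> = t} \<subseteq> ?L" by blast
  ultimately show ?thesis using card_mono finite_subset by (metis (no_types, lifting) le_trans)
qed

section \<open>Relating part sizes to \<^const>\<open>P\<close>\<close>

text \<open>The graph to be partitioned is \<open>E - {r}\<close>; the pendant edge marks the part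
  whose size is left out of the multiset.\<close>

locale pendant_edge =
  fixes E :: "'v set set" and r :: "'v set" and v :: 'v
  assumes finite_E: "finite E" and root: "r \<in> E" and v: "v \<in> r"
    and meets_root: "\<And>e. e \<in> E \<Longrightarrow> e \<noteq> r \<Longrightarrow> e \<inter> r \<subseteq> {v}"
    and two: "\<And>e. e \<in> E \<Longrightarrow> card e = 2"
begin

lemma econn_remove_root:
  assumes "econn F" "F \<subseteq> E"
  shows "econn (F - {r})"
proof -
  have "econn (F \<inter> - {r})"
    using assms(1)
  proof (rule econn_branch[where v = v])
    fix e f assume "e \<in> F" "e \<in> - {r}" "f \<in> F" "f \<notin> - {r}"
    then show "e \<inter> f \<subseteq> {v}" using meets_root[of e] assms(2) by auto
  qed
  then show ?thesis by (simp add: Diff_eq)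
qed

text \<open>A partition of \<open>E - {r}\<close> becomes a colouring of \<open>E\<close> once
  \<open>r\<close> is added to the part of \<open>f\<close>. The other \<open>k - 1\<close> sizes
  determine the sorted tuple, since the missing entry is what they leave of the number of edges;
  \<open>sort_desc\<close> performs this reconstruction.\<close>

lemma P_le_card_sizes:
  assumes G: "edges G = E - {r}" and f: "f \<in> E" "f \<noteq> r" "v \<in> f" and k: "k \<ge> 1"
    and fin: "finite {\<mu> \<in> sizes E r. size \<mu> = k - 1}"
  shows "P G k \<le> card {\<mu> \<in> sizes E r. size \<mu> = k - 1}"
proof -
  let ?L = "{\<mu> \<in> sizes E r. size \<mu> = k - 1}"
  define sort_desc where "sort_desc \<mu> = rev (sorted_list_of_multiset (add_mset (card (E - {r}) - \<Sum>\<^sub># \<mu>) \<mu>))"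
    for \<mu> :: "nat multiset"
  have "ms \<in> sort_desc ` ?L"
    if len: "length ms = k" and sorted: "sorted_wrt (\<ge>) ms" and pos: "\<forall>m\<in>set ms. m \<ge> 1"
      and part: "connected_edge_partition G ms Es" for ms Es
  proof -
    have sum: "sum_list ms = card (E - {r})" and lenE: "length Es = k"
      and un: "\<Union> (set Es) = E - {r}"
      and dis: "\<And>i j. i < k \<Longrightarrow> j < k \<Longrightarrow> i \<noteq> j \<Longrightarrow> Es ! i \<inter> Es ! j = {}"
      and card: "\<And>i. i < k \<Longrightarrow> card (Es ! i) = ms ! i"
      and conn: "\<And>i. i < k \<Longrightarrow> connected_graph (edge_induced (Es ! i))"
      using part len unfolding connected_edge_partition_def G by simp_all
    have sub: "Es ! i \<subseteq> E - {r}" if "i < k" for i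
      using un lenE that by (metis Union_upper nth_mem)
    have econn: "econn (Es ! i)" if "i < k" for i
      using connected_graph_edge_induced_iff[of "Es ! i"] conn[OF that] sub[OF that] two by blast
    define idx where "idx e = (SOME i. i < k \<and> e \<in> Es ! i)" for e
    have idx: "idx e < k \<and> e \<in> Es ! idx e" if "e \<in> E - {r}" for e
    proof -
      have "\<exists>i. i < k \<and> e \<in> Es ! i" using that un lenE by (metis UnionE in_set_conv_nth)
      then show ?thesis unfolding idx_def by (rule someI_ex)
    qed
    have idx_eq: "idx e = i" if "i < k" "e \<in> Es ! i" for e i
    proof (rule ccontr)
      assume "idx e \<noteq> i"
      moreover have "e \<in> E - {r}" using sub that by blast
      ultimately show False using dis[of "idx e" i] idx[of e] that by blast
    qed
    define j where "j = idx f"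
    have j: "j < k" "f \<in> Es ! j" using idx[of f] f by (auto simp: j_def)
    \<comment> \<open>\<open>f\<close> and \<open>r\<close> share the vertex \<open>v\<close>, so
      the part of \<open>f\<close> stays connected when it receives \<open>r\<close>.\<close>
    define c where "c e = (if e = r then j else idx e)" for e
    have cls: "colour_class E c i = Es ! i" if "i < k" "i \<noteq> j" for i
    proof
      show "colour_class E c i \<subseteq> Es ! i"
        using idx that by (auto simp: colour_class_def c_def split: if_splits)
      show "Es ! i \<subseteq> colour_class E c i"
        using sub[of i] idx_eq[of i] that by (auto simp: colour_class_def c_def)
    qed
    have clsj: "colour_class E c j = insert r (Es ! j)"
    proof
      show "colour_class E c j \<subseteq> insert r (Es ! j)"
        using idx by (auto simp: colour_class_def c_def split: if_splits)
      show "insert r (Es ! j) \<subseteq> colour_class E c j"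
        using sub[of j] idx_eq[of j] j root by (auto simp: colour_class_def c_def)
    qed
    have cls0: "colour_class E c i = {}" if "\<not> i < k" for i
      using that idx j by (auto simp: colour_class_def c_def)
    have "econn (colour_class E c i)" for i
    proof -
      consider "i = j" | "i < k" "i \<noteq> j" | "\<not> i < k" by blast
      then show ?thesis
      proof cases
        case 1
        have "f \<inter> r \<noteq> {}" using f v by blast
        then show ?thesis using 1 clsj econn_insert[OF econn[OF j(1)] j(2)] by simp
      qed (simp_all add: cls econn cls0)
    qed
    then have mem: "other_sizes E r c \<in> sizes E r" unfolding sizes_def by blast
    have nonempty: "Es ! i \<noteq> {}" if "i < k" for i
    proof -
      have "ms ! i \<ge> 1" using pos that len by simp
      then show ?thesis using card[OF that] by auto
    qed
    have img: "c ` E - {c r} = {..<k} - {j}"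
    proof
      show "c ` E - {c r} \<subseteq> {..<k} - {j}" using idx by (auto simp: c_def)
      show "{..<k} - {j} \<subseteq> c ` E - {c r}"
      proof
        fix i assume i: "i \<in> {..<k} - {j}"
        then obtain e where "e \<in> Es ! i" using nonempty by blast
        then have "e \<in> E" "c e = i" using sub[of i] idx_eq[of i e] i by (auto simp: c_def)
        moreover have "c r = j" by (simp add: c_def)
        ultimately show "i \<in> c ` E - {c r}" using i by blast
      qed
    qed
    define \<mu> where "\<mu> = other_sizes E r c"
    have "\<mu> = image_mset ((!) ms) (mset_set ({..<k} - {j}))"
      unfolding \<mu>_def other_sizes_def img using cls card by (intro image_mset_cong) simp
    moreover have "mset_set {..<k} = add_mset j (mset_set ({..<k} - {j}))"
      using j(1) by (simp add: mset_set.remove)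
    moreover have "mset ms = image_mset ((!) ms) (mset_set {..<k})"
    proof -
      have "image_mset ((!) ms) (mset_set {..<k}) = mset (map ((!) ms) [0..<k])"
        by (simp only: mset_map mset_upt atLeast0LessThan)
      then show ?thesis using map_nth[of ms] len by metis
    qed
    ultimately have ms: "mset ms = add_mset (ms ! j) \<mu>" by simp
    have "size \<mu> = k - 1" using arg_cong[OF ms, of size] len by simp
    moreover have "sum_list ms = ms ! j + \<Sum>\<^sub># \<mu>"
      using arg_cong[OF ms, of sum_mset] by (simp add: sum_mset_sum_list)
    then have "sort_desc \<mu> = rev (sort ms)"
      using sum ms by (simp add: sort_desc_def flip: sorted_list_of_multiset_mset)
    moreover have "sort ms = rev ms"
      by (rule properties_for_sort) (use sorted in \<open>simp_all add: sorted_wrt_rev\<close>)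
    ultimately have "ms = sort_desc \<mu>" "\<mu> \<in> ?L" using mem by (simp_all add: \<mu>_def)
    then show ?thesis by blast
  qed
  then have "{ms. length ms = k \<and> sorted_wrt (\<ge>) ms \<and> (\<forall>m\<in>set ms. m \<ge> 1) \<and>
      (\<exists>Es. connected_edge_partition G ms Es)} \<subseteq> sort_desc ` ?L"
    by blast
  then have "P G k \<le> card (sort_desc ` ?L)" unfolding P_def using fin by (intro card_mono) auto
  also have "\<dots> \<le> card ?L" using fin by (rule card_image_le)
  finally show ?thesis .
qed

text \<open>The bound on the sum leaves at least two edges to the part of \<open>r\<close>, so that
  this part is still nonempty after the removal of \<open>r\<close>; it stays connected because
  \<open>r\<close> is pendant. Its new size is the entry \<open>x\<close>.\<close>

lemma partition_of_sizes:
  assumes G: "edges G = E - {r}" and \<mu>: "\<mu> \<in> sizes E r" "\<Sum>\<^sub># \<mu> + 2 \<le> card E"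
  shows "\<exists>ms x. length ms = size \<mu> + 1 \<and> sorted_wrt (\<ge>) ms \<and> (\<forall>m\<in>set ms. m \<ge> 1) \<and>
    (\<exists>Es. connected_edge_partition G ms Es) \<and> x \<in> set ms \<and> \<mu> = mset ms - {#x#}"
proof -
  obtain c where c: "\<mu> = other_sizes E r c" "\<And>z. econn (colour_class E c z)"
    using \<mu>(1) by (auto simp: sizes_def)
  define E' where "E' = E - {r}"
  define Z where "Z = c ` E"
  define cls where "cls = colour_class E' c"
  define f where "f z = card (cls z)" for z
  have finZ: "finite Z" and finE': "finite E'" using finite_E by (simp_all add: Z_def E'_def)
  have cls_eq: "cls z = colour_class E c z - {r}" for z
    by (auto simp: cls_def E'_def colour_class_def)
  have cls_other: "cls z = colour_class E c z" if "z \<noteq> c r" for z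
    using that by (auto simp: cls_eq colour_class_def)
  have econn: "econn (cls z)" for z
    unfolding cls_eq by (rule econn_remove_root[OF c(2)]) (auto simp: colour_class_def)
  have fin_cls: "finite (cls z)" for z using finE' by (simp add: cls_def colour_class_def)
  have f_pos: "f z \<ge> 1" if "z \<in> Z" for z
  proof (cases "z = c r")
    case True
    have "card (colour_class E c (c r)) \<ge> 2"
      using card_root_class[OF finite_E root, of c] \<mu>(2) by (simp add: c(1))
    moreover have "r \<in> colour_class E c (c r)" using root by (simp add: colour_class_def)
    ultimately show ?thesis using True by (simp add: f_def cls_eq card_Diff_singleton)
  next
    case False
    have "colour_class E c z \<noteq> {}" using that by (auto simp: Z_def colour_class_def)
    then show ?thesis using False fin_cls[of z] cls_other[OF False]
      by (simp add: f_def Suc_le_eq card_gt_0_iff)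
  qed
  have cE': "c ` E' = Z"
  proof
    show "c ` E' \<subseteq> Z" by (auto simp: Z_def E'_def)
    show "Z \<subseteq> c ` E'"
    proof
      fix z assume "z \<in> Z"
      then have "cls z \<noteq> {}" using f_pos[of z] by (auto simp: f_def)
      then show "z \<in> c ` E'" by (auto simp: cls_def colour_class_def)
    qed
  qed
  define zs where "zs = rev (sort_key f (sorted_list_of_set Z))"
  have zs: "distinct zs" "set zs = Z"
    using finZ by (simp_all add: zs_def)
  then have mset_zs: "mset zs = mset_set Z" using mset_set_set[of zs] by simp
  define ms where "ms = map f zs"
  define Es where "Es = map cls zs"
  have sorted: "sorted_wrt (\<ge>) ms"
    using sorted_sort_key[of f "sorted_list_of_set Z"]
    by (simp add: ms_def zs_def rev_map[symmetric] sorted_wrt_rev)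
  have "mset_set Z = add_mset (c r) (mset_set (Z - {c r}))"
    using finZ root by (simp add: Z_def mset_set.remove)
  moreover have "mset ms = image_mset f (mset_set Z)" using mset_zs by (simp add: ms_def)
  moreover have "\<mu> = image_mset f (mset_set (Z - {c r}))"
    unfolding c(1) other_sizes_def Z_def[symmetric] f_def
    using cls_other finZ by (intro image_mset_cong) simp
  ultimately have ms: "mset ms = add_mset (f (c r)) \<mu>" by simp
  have "length ms = size \<mu> + 1" using arg_cong[OF ms, of size] by simp
  moreover have "\<forall>m\<in>set ms. m \<ge> 1" using f_pos zs by (simp add: ms_def)
  moreover have "f (c r) \<in> set ms" using zs root by (simp add: ms_def Z_def)
  moreover have "\<mu> = mset ms - {#f (c r)#}" using ms by simp
  moreover have "connected_edge_partition G ms Es"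
    unfolding connected_edge_partition_def
  proof (intro conjI allI impI)
    have "sum_list ms = (\<Sum>z\<in>Z. f z)" using zs by (simp add: ms_def sum_list_distinct_conv_sum_set)
    then show "sum_list ms = card (edges G)"
      using card_eq_sum_colour_classes[OF finE', of c, unfolded cE'] G
      by (simp add: f_def cls_def E'_def[symmetric])
    show "length Es = length ms" by (simp add: Es_def ms_def)
    have "\<Union> (set Es) = (\<Union>z\<in>Z. cls z)" using zs by (simp add: Es_def)
    also have "\<dots> = E'" by (auto simp: cls_def colour_class_def cE'[symmetric])
    finally show "\<Union> (set Es) = edges G" using G by (simp add: E'_def)
    show "Es ! i \<inter> Es ! j = {}" if "i < length Es" "j < length Es" "i \<noteq> j" for i j
    proof -
      have "zs ! i \<noteq> zs ! j" using that zs(1) by (simp add: Es_def nth_eq_iff_index_eq)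
      then show ?thesis using that by (auto simp: Es_def cls_def colour_class_def)
    qed
    show "card (Es ! i) = ms ! i" if "i < length Es" for i
      using that by (simp add: Es_def ms_def f_def)
    show "connected_graph (edge_induced (Es ! i))" if "i < length Es" for i
    proof -
      have "\<And>e. e \<in> cls (zs ! i) \<Longrightarrow> card e = 2"
        using two by (simp add: cls_def colour_class_def E'_def)
      then show ?thesis
        using connected_graph_edge_induced_iff[of "cls (zs ! i)"] econn that by (simp add: Es_def)
    qed
  qed
  ultimately show ?thesis using sorted by blast
qed

text \<open>Each multiset arises from a sorted tuple by deleting one entry, and a tuple of length
  \<open>k\<close> has at most \<open>k\<close> different entries to delete.\<close>

lemma card_sizes_le_P:
  assumes G: "edges G = E - {r}"
    and N: "\<And>\<mu>. \<mu> \<in> N \<Longrightarrow> \<mu> \<in> sizes E r \<and> size \<mu> + 1 = k \<and> \<Sum>\<^sub># \<mu> + 2 \<le> card E"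
  shows "card N \<le> k * P G k"
proof -
  define Q where "Q = {ms. length ms = k \<and> sorted_wrt (\<ge>) ms \<and> (\<forall>m\<in>set ms. m \<ge> 1) \<and>
      (\<exists>Es. connected_edge_partition G ms Es)}"
  have "Q \<subseteq> {ms. set ms \<subseteq> {..card (edges G)} \<and> length ms = k}"
  proof
    fix ms assume "ms \<in> Q"
    then have "length ms = k" "sum_list ms = card (edges G)"
      by (auto simp: Q_def connected_edge_partition_def)
    then show "ms \<in> {ms. set ms \<subseteq> {..card (edges G)} \<and> length ms = k}"
      using member_le_sum_list[of _ ms] by auto
  qed
  then have finQ: "finite Q" by (rule finite_subset) (simp add: finite_lists_length_eq)
  define R where "R = (SIGMA ms:Q. set ms)"
  have finR: "finite R" using finQ by (simp add: R_def)
  have "N \<subseteq> (\<lambda>(ms, x). mset ms - {#x#}) ` R"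
  proof
    fix \<mu> assume "\<mu> \<in> N"
    then obtain ms x where "length ms = k" "sorted_wrt (\<ge>) ms" "\<forall>m\<in>set ms. m \<ge> 1"
      "\<exists>Es. connected_edge_partition G ms Es" "x \<in> set ms" "\<mu> = mset ms - {#x#}"
      using partition_of_sizes[OF G, of \<mu>] N[of \<mu>] by metis
    then have "(ms, x) \<in> R" "\<mu> = (\<lambda>(ms, x). mset ms - {#x#}) (ms, x)" by (simp_all add: R_def Q_def)
    then show "\<mu> \<in> (\<lambda>(ms, x). mset ms - {#x#}) ` R" by (rule rev_image_eqI)
  qed
  then have "card N \<le> card ((\<lambda>(ms, x). mset ms - {#x#}) ` R)" using finR by (intro card_mono) auto
  also have "\<dots> \<le> card R" using finR by (rule card_image_le)
  also have "\<dots> = (\<Sum>ms\<in>Q. card (set ms))" unfolding R_def using finQ by simp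
  also have "\<dots> \<le> (\<Sum>ms\<in>Q. k)"
  proof (rule sum_mono)
    fix ms assume "ms \<in> Q"
    then show "card (set ms) \<le> k" using card_length[of ms] by (simp add: Q_def)
  qed
  also have "\<dots> = k * P G k" by (simp add: P_def Q_def)
  finally show ?thesis .
qed

end

section \<open>Constructing partitions\<close>

lemma (in junction) econn_join:
  assumes "econn X" "econn Y"
  shows "econn E"
proof -
  have "econn (X \<union> Y)"
    using p_in rx ry by (intro econn_Un[OF assms, of rx ry]) auto
  then show ?thesis
    unfolding edges_eq using p_in rx by (intro econn_insert[of _ rx]) auto
qed

section \<open>Base graphs and cuts along a path of branches\<close>

text \<open>Only the edges towards larger vertices are taken, which makes the edge sets of different
  hubs disjoint: an edge between two hubs belongs to the smaller one.\<close>

definition hub_edges :: "nat \<Rightarrow> nat \<Rightarrow> nat set set" where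
  "hub_edges h u = {{u, v} |v. u < v \<and> v \<le> h}"

lemma hub_edgeI: "u < v \<Longrightarrow> v \<le> h \<Longrightarrow> {u, v} \<in> hub_edges h u"
  unfolding hub_edges_def by blast

lemma hub_edges_subset: "1 \<le> u \<Longrightarrow> hub_edges h u \<subseteq> edges_on h"
  by (auto simp: hub_edges_def edges_on_def)

lemma finite_hub_edges: "finite (hub_edges h u)" and card_hub_edges_le: "card (hub_edges h u) \<le> h - u"
proof -
  have eq: "hub_edges h u = (\<lambda>v. {u, v}) ` {u<..h}" by (auto simp: hub_edges_def)
  show "finite (hub_edges h u)" unfolding eq by simp
  show "card (hub_edges h u) \<le> h - u"
    unfolding eq using card_image_le[of "{u<..h}" "\<lambda>v. {u, v}"] by simp
qed

lemma edges_on_pair: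
  assumes "e \<in> edges_on h"
  obtains x y where "e = {x, y}" "1 \<le> x" "x < y" "y \<le> h"
proof -
  obtain a b where ab: "e = {a, b}" "a \<noteq> b" using assms by (auto simp: edges_on_def card_2_iff)
  then have le: "1 \<le> a" "a \<le> h" "1 \<le> b" "b \<le> h" using assms by (auto simp: edges_on_def)
  show thesis
  proof (cases "a < b")
    case True
    then show thesis using that[of a b] ab le by simp
  next
    case False
    then show thesis using that[of b a] ab le by (simp add: insert_commute)
  qed
qed

lemma card_edges_on: "card (edges_on h) = h choose 2"
  using n_subsets[of "{1..h}" 2] by (simp add: edges_on_def)

text \<open>The star at 1 makes \<open>H\<close> connected and lets it cover all of
  \<open>{1..h}\<close>, while its remaining edges stay free to be chosen.\<close>

locale base_graph =
  fixes H :: "nat set set" and h :: nat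
  assumes H: "H \<subseteq> edges_on h" and star: "hub_edges h 1 \<subseteq> H" and h: "h \<ge> 2"
begin

lemma finite_H: "finite H"
  using finite_subset[OF H finite_edges_on] .

lemma star_edge: "{1, 2} \<in> H"
  using star hub_edgeI[of 1 2 h] h by auto

lemma card_planted_0: "card (planted H 0) = card H + 1"
proof -
  have "{0, 1} \<notin> H" using H by (auto simp: edges_on_def)
  then show ?thesis using finite_H by simp
qed

lemma card_planted_Suc: "card (planted H (Suc i)) = 2 * card (planted H i) + 1"
proof -
  interpret junction "planted H (Suc i)" "(`) (child_map 0) ` planted H i" "(`) (child_map 1) ` planted H i"
    "{0, 1}" "child_map 0 ` {0, 1}" "child_map 1 ` {0, 1}" 1
    by (rule junction_planted[OF H])
  show ?thesis
    unfolding edges_eq using finite_X finite_Y r_notin disjoint card_branch[of 0 H i] card_branch[of 1 H i]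
    by (simp add: card_Un_disjoint)
qed

lemma card_planted: "card (planted H i) + 1 = 2 ^ i * (card H + 2)"
  by (induction i) (simp_all add: card_planted_0 card_planted_Suc del: planted.simps)

lemma econn_planted: "econn (planted H i)"
proof (induction i)
  case 0
  show ?case
  proof (rule econn_hub[where v = 1])
    show "insert {0, 1} (hub_edges h 1) \<subseteq> planted H 0" using star by auto
    show "1 \<in> e" if "e \<in> insert {0, 1} (hub_edges h 1)" for e
      using that by (auto simp: hub_edges_def)
    show "\<exists>f\<in>insert {0, 1} (hub_edges h 1). e \<inter> f \<noteq> {}" if "e \<in> planted H 0" for e
    proof (cases "e = {0, 1}")
      case False
      then have "e \<in> edges_on h" using that H by auto
      then obtain x y where xy: "e = {x, y}" "1 \<le> x" "x < y" "y \<le> h" by (rule edges_on_pair)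
      then have "{1, y} \<in> hub_edges h 1" by (auto simp: hub_edges_def)
      then show ?thesis using xy by (intro bexI[of _ "{1, y}"]) simp_all
    qed auto
  qed
next
  case (Suc i)
  have "econn ((`) (child_map t) ` planted H i)" if "t \<le> 1" for t
    using econn_image_iff[OF inj_child_map[OF that]] Suc by blast
  then show ?case by (intro junction.econn_join[OF junction_planted[OF H]]) simp_all
qed

lemma sizes_planted_extend:
  assumes "\<mu> \<in> sizes (planted H i) {0, 1}"
  shows "\<mu> \<in> sizes (planted H (Suc i)) {0, 1}"
    and "add_mset (card (planted H i)) \<mu> \<in> sizes (planted H (Suc i)) {0, 1}"
proof -
  have "\<mu> \<in> sizes ((`) (child_map 0) ` planted H i) (child_map 0 ` {0, 1})"
    using assms by (simp only: sizes_image[OF inj_child_map[OF zero_le]])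
  moreover have "econn ((`) (child_map 1) ` planted H i)"
    using econn_image_iff[OF inj_child_map[of 1]] econn_planted by simp
  ultimately show "\<mu> \<in> sizes (planted H (Suc i)) {0, 1}"
    and "add_mset (card (planted H i)) \<mu> \<in> sizes (planted H (Suc i)) {0, 1}"
    using junction.sizes_extend[OF junction_planted[OF H], of \<mu> i] card_branch[of 1 H i]
    by (simp_all del: planted.simps)
qed

lemma sizes_planted_mono:
  assumes "\<mu> \<in> sizes (planted H 0) {0, 1}"
  shows "\<mu> \<in> sizes (planted H i) {0, 1}"
  by (induction i) (use assms sizes_planted_extend in blast)+

lemma empty_in_sizes: "{#} \<in> sizes (planted H 0) {0, 1}"
proof -
  have "econn (colour_class (planted H 0) (\<lambda>_. 0) z)" for z
    using econn_planted[of 0] by (cases "z = 0") (simp_all add: colour_class_def del: planted.simps)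
  moreover have "other_sizes (planted H 0) {0, 1} (\<lambda>_. 0) = {#}"
  proof -
    have "(\<lambda>_. 0 :: nat) ` planted H 0 - {0} = {}" by auto
    then show ?thesis by (simp only: other_sizes_def mset_set.empty image_mset_empty)
  qed
  ultimately show ?thesis unfolding sizes_def by (intro CollectI exI[of _ "\<lambda>_. 0"]) simp
qed

text \<open>Going up a path of branches, one meets at each step a sibling that is a whole copy of
  the tree built so far. It is cut off if its level is in \<open>S\<close> and absorbed by the root
  part otherwise.\<close>

lemma cut_branches_in_sizes:
  assumes "S \<subseteq> {..<i}"
  shows "image_mset (\<lambda>j. card (planted H j)) (mset_set S) \<in> sizes (planted H i) {0, 1}"
  using assms
proof (induction i arbitrary: S)
  case 0
  then show ?case using empty_in_sizes by simp
next
  case (Suc i)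
  have fin: "finite S" using Suc.prems by (rule finite_subset) simp
  have "S - {i} \<subseteq> {..<i}" using Suc.prems by auto
  note IH = sizes_planted_extend[OF Suc.IH[OF this]]
  show ?case
  proof (cases "i \<in> S")
    case True
    then show ?thesis using IH(2) fin by (simp add: mset_set.remove del: planted.simps)
  next
    case False
    then show ?thesis using IH(1) by (simp del: planted.simps)
  qed
qed

text \<open>Even if siblings are cut off on all levels, the root part keeps
  \<open>card H + 1 + i\<close> edges, enough to survive the removal of the planted edge.\<close>

lemma sum_card_planted: "(\<Sum>j<i. card (planted H j)) + card H + 1 + i = card (planted H i)"
  by (induction i) (simp_all add: card_planted_0 card_planted_Suc del: planted.simps)

lemma strict_mono_card_planted: "strict_mono (\<lambda>j. card (planted H j))"
  by (rule strict_mono_Suc_iff[THEN iffD2]) (simp add: card_planted_Suc del: planted.simps)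

lemma pendant_planted: "pendant_edge (planted H i) {0, 1} 1"
proof
  show "e \<inter> {0, 1} \<subseteq> {1}" if "e \<in> planted H i" "e \<noteq> {0, 1}" for e
  proof -
    have "0 \<notin> e" using zero_in_planted_edge[OF H] that by blast
    then show ?thesis by blast
  qed
qed (fact finite_planted[OF H], fact root_in_planted[OF H], simp, fact card_planted_edge[OF H])

lemma root_has_child: "\<exists>f\<in>planted H i. f \<noteq> {0, 1} \<and> 1 \<in> f"
proof (cases i)
  case 0
  have "{1, 2} \<in> planted H i" "{1, 2} \<noteq> {0, 1 :: nat}"
    using 0 star_edge by (simp_all add: doubleton_eq_iff)
  then show ?thesis by (intro bexI[of _ "{1, 2}"]) simp_all
next
  case (Suc j)
  have "child_map 0 ` {0, 1} \<in> (`) (child_map 0) ` planted H j"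
    using imageI[where f = "(`) (child_map 0)", OF root_in_planted[OF H]] by metis
  then have "child_map 0 ` {0, 1} \<in> planted H (Suc j)"
    unfolding planted.simps by (rule UnI1[THEN insertI2])
  moreover have "child_map 0 ` {0, 1} = {1, 2}" by (simp add: child_map_def insert_commute)
  ultimately have "{1, 2} \<in> planted H i" using Suc by metis
  moreover have "{1, 2} \<noteq> {0, 1 :: nat}" by (simp add: doubleton_eq_iff)
  ultimately show ?thesis by (intro bexI[of _ "{1, 2}"]) simp_all
qed

text \<open>The subtree sizes increase strictly with the level, so different sets of levels give
  different multisets of sizes.\<close>

lemma choose_levels_le_P:
  assumes G: "edges G = planted H b - {{0, 1}}" and k: "k \<ge> 1"
  shows "b choose (k - 1) \<le> k * P G k"
proof -
  interpret pendant_edge "planted H b" "{0, 1}" 1 by (rule pendant_planted)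
  define F where "F j = card (planted H j)" for j
  define Q where "Q = {S. S \<subseteq> {..<b} \<and> card S = k - 1}"
  define N where "N = (\<lambda>S. image_mset F (mset_set S)) ` Q"
  have F: "inj F" using strict_mono_card_planted unfolding F_def by (rule strict_mono_imp_inj_on)
  have finS: "finite S" if "S \<in> Q" for S using that finite_subset unfolding Q_def by blast
  have "inj_on (\<lambda>S. image_mset F (mset_set S)) Q"
  proof (rule inj_onI)
    fix S T assume ST: "S \<in> Q" "T \<in> Q" "image_mset F (mset_set S) = image_mset F (mset_set T)"
    have "mset_set (F ` S) = mset_set (F ` T)"
      using ST(3) by (simp only: image_mset_mset_set[OF inj_on_subset[OF F subset_UNIV]])
    then have "F ` S = F ` T" using finS ST(1,2) by (simp add: mset_set_eq_iff)
    then show "S = T" using F by (simp add: inj_image_eq_iff)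
  qed
  then have "card N = card Q" by (simp add: N_def card_image)
  also have "\<dots> = b choose (k - 1)" using n_subsets[of "{..<b}" "k - 1"] by (simp add: Q_def)
  finally have "card N = b choose (k - 1)" .
  moreover have "card N \<le> k * P G k"
  proof (rule card_sizes_le_P[OF G])
    fix \<mu> assume "\<mu> \<in> N"
    then obtain S where S: "S \<subseteq> {..<b}" "card S = k - 1" "\<mu> = image_mset F (mset_set S)"
      by (auto simp: N_def Q_def)
    have "\<Sum>\<^sub># \<mu> = (\<Sum>j\<in>S. F j)" by (simp add: S sum_unfold_sum_mset)
    also have "\<dots> \<le> (\<Sum>j<b. F j)" using S by (intro sum_mono2) auto
    finally have "\<Sum>\<^sub># \<mu> + 2 \<le> card (planted H b)"
      using sum_card_planted[of b] star_edge finite_H card_gt_0_iff[of H] by (auto simp: F_def)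
    moreover have "size \<mu> + 1 = k" using S k by simp
    moreover have "\<mu> \<in> sizes (planted H b) {0, 1}"
      using cut_branches_in_sizes[OF S(1)] by (simp add: S(3) F_def[abs_def])
    ultimately show "\<mu> \<in> sizes (planted H b) {0, 1} \<and> size \<mu> + 1 = k \<and> \<Sum>\<^sub># \<mu> + 2 \<le> card (planted H b)"
      by blast
  qed
  ultimately show ?thesis by simp
qed

lemma P_le:
  assumes G: "edges G = planted H b - {{0, 1}}" and k: "k \<ge> 1"
  shows "P G k \<le> count_const (k - 1) * (card H + b + 1) ^ (k - 1)"
proof -
  interpret pendant_edge "planted H b" "{0, 1}" 1 by (rule pendant_planted)
  obtain f where f: "f \<in> planted H b" "f \<noteq> {0, 1}" "1 \<in> f" using root_has_child by blast
  note L = card_sizes_planted_le[OF H, of b "k - 1"]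
  show ?thesis using P_le_card_sizes[OF G f k] L by simp
qed

lemma Union_planted: "\<Union>H = {1..h} \<Longrightarrow> \<Union>(planted H i) = {0..2 ^ i * (h + 1) - 1}"
proof (induction i)
  case 0
  have "{0, 1} \<union> {1..h} = {0..h}"
    using h atLeastAtMost_insertL[of 0 h] by (simp add: insert_absorb)
  then show ?case using 0 by simp
next
  case (Suc i)
  define n where "n = 2 ^ i * (h + 1) - 1"
  have "n \<ge> 1" using h mult_le_mono[of 1 "2 ^ i" 2 "h + 1"] by (simp add: n_def)
  have Suc_n: "2 ^ Suc i * (h + 1) - 1 = 2 * n + 1"
  proof -
    define m where "m = 2 ^ i * (h + 1)"
    have "m > 0" by (simp only: m_def) simp
    moreover have "2 ^ Suc i * (h + 1) = 2 * m" by (simp add: m_def)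
    moreover have "n = m - 1" by (simp add: n_def m_def)
    ultimately show ?thesis by linarith
  qed
  have img: "\<Union>((`) (child_map t) ` planted H i) = child_map t ` {0..n}" for t
    using Suc by (simp add: n_def flip: image_Union)
  have "{0, 1} \<union> child_map 0 ` {0..n} \<union> child_map 1 ` {0..n} = {0..2 * n + 1}"
  proof
    show "{0, 1} \<union> child_map 0 ` {0..n} \<union> child_map 1 ` {0..n} \<subseteq> {0..2 * n + 1}"
      using \<open>n \<ge> 1\<close> by (auto simp: child_map_def)
    show "{0..2 * n + 1} \<subseteq> {0, 1} \<union> child_map 0 ` {0..n} \<union> child_map 1 ` {0..n}"
    proof
      fix y assume y: "y \<in> {0..2 * n + 1}"
      show "y \<in> {0, 1} \<union> child_map 0 ` {0..n} \<union> child_map 1 ` {0..n}"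
      proof (cases "y \<le> 1")
        case False
        \<comment> \<open>The last binary digit selects the branch and the remaining digits give the
          preimage, which is positive because \<open>y \<ge> 2\<close>.\<close>
        have "y = child_map (y mod 2) (y div 2)" "y div 2 \<in> {0..n}"
          using False y by (auto simp: child_map_def)
        moreover have "y mod 2 = 0 \<or> y mod 2 = 1" by auto
        ultimately show ?thesis by (metis UnCI image_eqI)
      qed auto
    qed
  qed
  then show ?case unfolding Suc_n by (simp add: img Un_assoc)
qed

lemma tree_graph:
  assumes "edges G = planted H b - {{0, 1}}" "verts G = {1..2 ^ b * (h + 1) - 1}"
  shows "simple_graph G" "connected_graph G"
proof -
  interpret pendant_edge "planted H b" "{0, 1}" 1 by (rule pendant_planted)
  have UH: "\<Union>H = {1..h}"
  proof
    show "\<Union>H \<subseteq> {1..h}" using H by (auto simp: edges_on_def)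
    show "{1..h} \<subseteq> \<Union>H"
    proof
      fix v assume v: "v \<in> {1..h}"
      show "v \<in> \<Union>H"
      proof (cases "v = 1")
        case True
        then show ?thesis using star_edge by blast
      next
        case False
        then have "{1, v} \<in> H" using star hub_edgeI[of 1 v h] v by auto
        then show ?thesis by blast
      qed
    qed
  qed
  have zero: "0 \<notin> e" if "e \<in> planted H b - {{0, 1}}" for e
    using zero_in_planted_edge[OF H] that by blast
  have verts: "\<Union>(planted H b - {{0, 1}}) = verts G"
  proof
    show "\<Union>(planted H b - {{0, 1}}) \<subseteq> verts G"
    proof
      fix x assume x: "x \<in> \<Union>(planted H b - {{0, 1}})"
      then have "x \<in> \<Union>(planted H b)" "x \<noteq> 0" using zero by auto
      then show "x \<in> verts G" unfolding Union_planted[OF UH] assms(2) by auto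
    qed
    show "verts G \<subseteq> \<Union>(planted H b - {{0, 1}})"
    proof
      fix x assume "x \<in> verts G"
      then have x: "x \<in> \<Union>(planted H b)" "x \<noteq> 0" unfolding Union_planted[OF UH] assms(2) by auto
      show "x \<in> \<Union>(planted H b - {{0, 1}})"
      \<comment> \<open>Vertex 1 is an endpoint of the removed edge as well, so it needs another
        edge in order not to be lost.\<close>
      proof (cases "x = 1")
        case True
        then show ?thesis using root_has_child[of b] by blast
      next
        case False
        then have "x \<notin> {0, 1}" using x by simp
        then show ?thesis using x by blast
      qed
    qed
  qed
  show "simple_graph G"
    unfolding simple_graph_def
  proof (intro conjI ballI)
    show "finite (verts G)" by (simp add: assms(2))
    fix e assume e: "e \<in> edges G"
    then show "e \<subseteq> verts G" using verts assms(1) by blast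
    show "card e = 2" using e two assms(1) by simp
  qed
  have "connected_graph (edge_induced (planted H b - {{0, 1}}))"
    using connected_graph_edge_induced_iff[of "planted H b - {{0, 1}}"] two
      econn_remove_root[OF econn_planted order_refl] by simp
  moreover have "edge_induced (planted H b - {{0, 1}}) = \<lparr>verts = verts G, edges = edges G\<rparr>"
    using verts assms(1) by (simp add: edge_induced_def)
  ultimately show "connected_graph G" by (simp add: connected_graph_def adj_def)
qed

end

section \<open>Prescribing part sizes inside the base graph\<close>

text \<open>For the new index, \<open>B j\<close> is set aside first and the induction hypothesis is
  applied to the rest of \<open>U\<close>. What it leaves over still contains \<open>B j\<close>
  and, by the bound on the sum, is large enough to enlarge \<open>B j\<close> to \<open>t j\<close>
  elements.\<close>

lemma extend_to_disjoint_family: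
  assumes "finite I" "finite U"
    and "\<And>i. i \<in> I \<Longrightarrow> B i \<subseteq> U" "disjoint_family_on B I"
    and "\<And>i. i \<in> I \<Longrightarrow> card (B i) \<le> t i" "(\<Sum>i\<in>I. t i) \<le> card U"
  shows "\<exists>Z. (\<forall>i\<in>I. B i \<subseteq> Z i \<and> Z i \<subseteq> U \<and> card (Z i) = (t i :: nat)) \<and> disjoint_family_on Z I"
  using assms
proof (induction I arbitrary: U rule: finite_induct)
  case empty
  then show ?case by (simp add: disjoint_family_on_def)
next
  case (insert j I)
  define U' where "U' = U - B j"
  have Bj: "B j \<subseteq> U" "finite (B j)" "card (B j) \<le> t j"
    using insert.prems finite_subset by blast+
  have disj: "B i \<inter> B j = {}" if "i \<in> I" for i
    using insert.prems(3) insert.hyps(2) that by (auto simp: disjoint_family_on_def)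
  have sum: "t j + (\<Sum>i\<in>I. t i) \<le> card U" using insert.prems(5) insert.hyps by simp
  have "card U' = card U - card (B j)" using Bj by (simp add: U'_def card_Diff_subset)
  then have "(\<Sum>i\<in>I. t i) \<le> card U'" using sum Bj(3) by linarith
  moreover have "B i \<subseteq> U'" if "i \<in> I" for i using insert.prems(2)[of i] disj that by (auto simp: U'_def)
  moreover have "disjoint_family_on B I" using insert.prems(3) by (auto simp: disjoint_family_on_def)
  moreover have "finite U'" "\<And>i. i \<in> I \<Longrightarrow> card (B i) \<le> t i"
    using insert.prems(1,4) by (simp_all add: U'_def)
  ultimately have "\<exists>Z. (\<forall>i\<in>I. B i \<subseteq> Z i \<and> Z i \<subseteq> U' \<and> card (Z i) = t i) \<and> disjoint_family_on Z I"
    using insert.IH[of U'] by blast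
  then obtain Z where Z: "\<And>i. i \<in> I \<Longrightarrow> B i \<subseteq> Z i \<and> Z i \<subseteq> U' \<and> card (Z i) = t i"
    "disjoint_family_on Z I"
    by blast
  define W where "W = U - (\<Union>i\<in>I. Z i)"
  have finW: "finite W" using insert.prems(1) by (simp add: W_def)
  have UZ: "(\<Union>i\<in>I. Z i) \<subseteq> U'" using Z(1) by blast
  have finU': "finite U'" using insert.prems(1) by (simp add: U'_def)
  have "card (\<Union>i\<in>I. Z i) \<le> (\<Sum>i\<in>I. card (Z i))" using insert.hyps(1) by (rule card_UN_le)
  also have "\<dots> = (\<Sum>i\<in>I. t i)" using Z(1) by (intro sum.cong) auto
  finally have "t j \<le> card U - card (\<Union>i\<in>I. Z i)" using sum by linarith
  also have "\<dots> = card W"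
    unfolding W_def using UZ finite_subset[OF UZ finU'] by (intro card_Diff_subset[symmetric]) (auto simp: U'_def)
  finally have "t j \<le> card W" .
  moreover have "B j \<subseteq> W" using Bj UZ by (auto simp: W_def U'_def)
  ultimately obtain Y where Y: "B j \<subseteq> Y" "Y \<subseteq> W" "card Y = t j"
    using exists_subset_between[OF Bj(3), of W] finW by blast
  define Z' where "Z' = Z(j := Y)"
  have Z': "Z' j = Y" "\<And>i. i \<in> I \<Longrightarrow> Z' i = Z i" using insert.hyps(2) by (auto simp: Z'_def)
  have YZ: "Y \<inter> Z i = {}" if "i \<in> I" for i using Y(2) that by (auto simp: W_def)
  have "disjoint_family_on Z' (insert j I)"
    unfolding disjoint_family_on_def
  proof (intro ballI impI)
    fix m n assume mn: "m \<in> insert j I" "n \<in> insert j I" "m \<noteq> n"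
    then consider "m = j" "n \<in> I" | "n = j" "m \<in> I" | "m \<in> I" "n \<in> I" by blast
    then show "Z' m \<inter> Z' n = {}"
    proof cases
      case 1
      then show ?thesis using YZ Z' by simp
    next
      case 2
      then show ?thesis using YZ Z' by (simp add: Int_commute)
    next
      case 3
      then show ?thesis using Z(2) Z' mn by (simp add: disjoint_family_on_def)
    qed
  qed
  moreover have "\<forall>i\<in>insert j I. B i \<subseteq> Z' i \<and> Z' i \<subseteq> U \<and> card (Z' i) = t i"
  proof
    fix i assume "i \<in> insert j I"
    then consider "i = j" | "i \<in> I" by blast
    then show "B i \<subseteq> Z' i \<and> Z' i \<subseteq> U \<and> card (Z' i) = t i"
    proof cases
      case 1
      then show ?thesis using Y Z' by (auto simp: W_def)
    next
      case 2
      then show ?thesis using Z(1)[OF 2] Z'(2)[OF 2] by (auto simp: U'_def)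
    qed
  qed
  ultimately show ?case by blast
qed

lemma hub_edges_disjoint: "u < v \<Longrightarrow> hub_edges h u \<inter> hub_edges h v = {}"
  by (fastforce simp: hub_edges_def doubleton_eq_iff)

context base_graph
begin

text \<open>Sizes of at least \<open>h\<close> leave room for all edges of a hub. Sizes of at most
  \<open>card H div k\<close> leave the last of \<open>k\<close> shares, again at least
  \<open>h\<close>, to the part of hub 1. All other edges may be distributed arbitrarily, because
  every part contains the edges of its hub.\<close>

lemma hub_parts_in_sizes:
  assumes hubs: "\<And>i. 1 \<le> i \<Longrightarrow> i \<le> k \<Longrightarrow> hub_edges h i \<subseteq> H" and k: "k \<ge> 2"
    and S: "S \<subseteq> {h..card H div k}" "card S = k - 1"
  shows "mset_set S \<in> sizes (planted H 0) {0, 1}" and "\<Sum>\<^sub># (mset_set S) \<le> card H - h"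
proof -
  let ?I = "{2..k}"
  have finS: "finite S" using S(1) finite_subset by blast
  have "S \<noteq> {}" using S(2) k by auto
  then have he: "h \<le> card H div k" using S(1) by auto
  have sumS: "\<Sum>S + h \<le> card H"
  proof -
    have "i \<le> card H div k" if "i \<in> S" for i using S(1) that by auto
    then have "\<Sum>S \<le> card S * (card H div k)"
      using sum_bounded_above[of S "\<lambda>x. x" "card H div k"] by simp
    then have "\<Sum>S + h \<le> (k - 1) * (card H div k) + card H div k" using he S(2) by simp
    also have "\<dots> = k * (card H div k)" using k by (simp add: mult_eq_if)
    also have "\<dots> \<le> card H" by simp
    finally show ?thesis .
  qed
  then have "\<Sum>S \<le> card H - h" by linarith
  then show "\<Sum>\<^sub># (mset_set S) \<le> card H - h"
    using sum_unfold_sum_mset[of "\<lambda>x. x" S] by simp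
  obtain t where t: "bij_betw t ?I S"
    using finite_same_card_bij[of ?I S] finS S(2) by auto
  then have t_S: "t i \<in> S" if "i \<in> ?I" for i using that by (rule bij_betwE[rule_format])
  \<comment> \<open>The star at 1 is reserved for the part of the root edge, and the other parts are
    filled from the rest.\<close>
  define U where "U = H - hub_edges h 1"
  have finU: "finite U" using finite_H by (simp add: U_def)
  have "card U = card H - card (hub_edges h 1)"
    unfolding U_def using star finite_hub_edges by (rule card_Diff_subset[rotated])
  then have cardU: "card H - h \<le> card U" using card_hub_edges_le[of h 1] by linarith
  have "\<exists>Z. (\<forall>i\<in>?I. hub_edges h i \<subseteq> Z i \<and> Z i \<subseteq> U \<and> card (Z i) = t i) \<and> disjoint_family_on Z ?I"
  proof (rule extend_to_disjoint_family)
    show "hub_edges h i \<subseteq> U" if "i \<in> ?I" for i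
      using hubs[of i] hub_edges_disjoint[of 1 i h] that by (auto simp: U_def)
    show "disjoint_family_on (hub_edges h) ?I"
      unfolding disjoint_family_on_def
    proof (intro ballI impI)
      fix m n :: nat assume "m \<noteq> n"
      then show "hub_edges h m \<inter> hub_edges h n = {}"
        using hub_edges_disjoint[of m n h] hub_edges_disjoint[of n m h] by (cases "m < n") auto
    qed
    show "card (hub_edges h i) \<le> t i" if "i \<in> ?I" for i
    proof -
      have "h \<le> t i" using t_S[OF that] S(1) by (meson atLeastAtMost_iff subsetD)
      then show ?thesis using card_hub_edges_le[of h i] by linarith
    qed
    have "(\<Sum>i\<in>?I. t i) = \<Sum>S" using sum.reindex_bij_betw[OF t, of "\<lambda>x. x"] by simp
    then show "(\<Sum>i\<in>?I. t i) \<le> card U" using sumS cardU by linarith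
  qed (use finU in simp_all)
  then obtain Z where Z: "\<And>i. i \<in> ?I \<Longrightarrow> hub_edges h i \<subseteq> Z i" "\<And>i. i \<in> ?I \<Longrightarrow> Z i \<subseteq> U"
    "\<And>i. i \<in> ?I \<Longrightarrow> card (Z i) = t i" and disj: "disjoint_family_on Z ?I"
    by blast
  \<comment> \<open>Edges that no \<open>Z i\<close> claims, the root edge among them, get colour
    1.\<close>
  define c where "c e = (if \<exists>i\<in>?I. e \<in> Z i then THE i. i \<in> ?I \<and> e \<in> Z i else 1)" for e
  have c_eq: "c e = i" if "i \<in> ?I" "e \<in> Z i" for e i
  proof -
    have "(THE i. i \<in> ?I \<and> e \<in> Z i) = i"
    proof (rule the_equality)
      fix j assume j: "j \<in> ?I \<and> e \<in> Z j"
      show "j = i"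
      proof (rule ccontr)
        assume "j \<noteq> i"
        then have "Z j \<inter> Z i = {}" using disj j that(1) unfolding disjoint_family_on_def by blast
        then show False using j that(2) by blast
      qed
    qed (use that in simp)
    moreover have "\<exists>i\<in>?I. e \<in> Z i" using that by blast
    ultimately show ?thesis unfolding c_def by simp
  qed
  have c_1: "c e = 1" if "\<And>i. i \<in> ?I \<Longrightarrow> e \<notin> Z i" for e
    unfolding c_def using that by auto
  have r: "{0, 1} \<notin> H" using H by (auto simp: edges_on_def)
  have ZH: "Z i \<subseteq> H" if "i \<in> ?I" for i using Z(2)[OF that] by (auto simp: U_def)
  have cr: "c {0, 1} = 1" using r ZH by (intro c_1) blast
  have cls_Z: "colour_class (planted H 0) c i = Z i" if "i \<in> ?I" for i
  proof
    show "Z i \<subseteq> colour_class (planted H 0) c i"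
      using ZH[OF that] c_eq[OF that] by (auto simp: colour_class_def)
    show "colour_class (planted H 0) c i \<subseteq> Z i"
    proof
      fix e assume e: "e \<in> colour_class (planted H 0) c i"
      then have "c e = i" by (simp add: colour_class_def)
      then have "c e \<noteq> 1" using that by auto
      then obtain j where "j \<in> ?I" "e \<in> Z j" using c_1[of e] by blast
      then show "e \<in> Z i" using c_eq[of j e] \<open>c e = i\<close> by simp
    qed
  qed
  have hub_class: "hub_edges h 1 \<subseteq> colour_class (planted H 0) c 1"
  proof
    fix e assume e: "e \<in> hub_edges h 1"
    then have "c e = 1" using Z(2) by (intro c_1) (auto simp: U_def)
    then show "e \<in> colour_class (planted H 0) c 1" using e star by (auto simp: colour_class_def)
  qed
  have c_range: "c e = 1 \<or> c e \<in> ?I" for e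
    using c_eq[of _ e] c_1[of e] by blast
  have "econn (colour_class (planted H 0) c z)" for z
  proof -
    consider "z = 1" | "z \<in> ?I" | "z \<noteq> 1" "z \<notin> ?I" by blast
    then show ?thesis
    proof cases
      case 1
      show ?thesis
      proof (rule econn_hub[where v = 1])
        show "insert {0, 1} (hub_edges h 1) \<subseteq> colour_class (planted H 0) c z"
          using hub_class 1 cr by (simp add: colour_class_def)
        show "1 \<in> e" if "e \<in> insert {0, 1} (hub_edges h 1)" for e
          using that by (auto simp: hub_edges_def)
        show "\<exists>f\<in>insert {0, 1} (hub_edges h 1). e \<inter> f \<noteq> {}"
          if e: "e \<in> colour_class (planted H 0) c z" for e
        proof (cases "e = {0, 1}")
          case True
          then show ?thesis by (intro bexI[of _ "{0, 1}"]) simp_all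
        next
          case False
          then have "e \<in> edges_on h" using e H by (auto simp: colour_class_def)
          then obtain x y where xy: "e = {x, y}" "1 \<le> x" "x < y" "y \<le> h" by (rule edges_on_pair)
          then have "{1, y} \<in> insert {0, 1} (hub_edges h 1)" using hub_edgeI[of 1 y h] by simp
          then show ?thesis using xy by (intro bexI[of _ "{1, y}"]) simp_all
        qed
      qed
    next
      case 2
      have "econn (Z z)"
      proof (rule econn_hub[where v = z])
        show "hub_edges h z \<subseteq> Z z" by (rule Z(1)[OF 2])
        show "z \<in> e" if "e \<in> hub_edges h z" for e using that by (auto simp: hub_edges_def)
        show "\<exists>f\<in>hub_edges h z. e \<inter> f \<noteq> {}" if e: "e \<in> Z z" for e
        proof -
          have "e \<in> edges_on h" using e ZH[OF 2] H by blast
          then obtain x y where xy: "e = {x, y}" "1 \<le> x" "x < y" "y \<le> h" by (rule edges_on_pair)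
          \<comment> \<open>If the larger endpoint were at most \<open>z\<close>, the smaller one
            would be a hub \<open>x < z\<close>; the edge would then be among the edges of hub
            \<open>x\<close> and have colour \<open>x\<close> instead of \<open>z\<close>. So
            \<open>{z, y}\<close> is an edge of the hub \<open>z\<close>, and it meets the given
            one.\<close>
          have "z < y"
          proof (rule ccontr)
            assume "\<not> z < y"
            then have "x < z" using xy by simp
            have ex: "e \<in> hub_edges h x" using hub_edgeI[OF xy(3,4)] xy(1) by simp
            show False
            proof (cases "x = 1")
              case True
              then show False using ex e Z(2)[OF 2] by (auto simp: U_def)
            next
              case False
              then have "x \<in> ?I" using xy \<open>x < z\<close> 2 by simp
              then have "c e = x" using c_eq Z(1) ex by blast
              then show False using c_eq[OF 2 e] \<open>x < z\<close> by simp
            qed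
          qed
          then have "{z, y} \<in> hub_edges h z" using xy hub_edgeI by simp
          then show ?thesis using xy by (intro bexI[of _ "{z, y}"]) simp_all
        qed
      qed
      then show ?thesis by (simp only: cls_Z[OF 2])
    next
      case 3
      then have "colour_class (planted H 0) c z = {}"
        using c_range by (auto simp: colour_class_def simp del: planted.simps)
      then show ?thesis by simp
    qed
  qed
  moreover have "other_sizes (planted H 0) {0, 1} c = mset_set S"
  proof -
    have "c ` planted H 0 - {c {0, 1}} = ?I"
    proof
      show "c ` planted H 0 - {c {0, 1}} \<subseteq> ?I"
      proof
        fix z assume z: "z \<in> c ` planted H 0 - {c {0, 1}}"
        then obtain e where "z = c e" by blast
        then show "z \<in> ?I" using c_range[of e] cr z by simp
      qed
      show "?I \<subseteq> c ` planted H 0 - {c {0, 1}}"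
      proof
        fix i assume i: "i \<in> ?I"
        have "h \<le> t i" using t_S[OF i] S(1) by (meson atLeastAtMost_iff subsetD)
        then have "t i \<ge> 1" using h by linarith
        then have "Z i \<noteq> {}" using Z(3)[OF i] by auto
        then obtain e where e: "e \<in> Z i" by blast
        then have "c e = i" "e \<in> planted H 0" using c_eq[OF i] ZH[OF i] by auto
        then have "i \<in> c ` planted H 0" by blast
        then show "i \<in> c ` planted H 0 - {c {0, 1}}" using cr i by simp
      qed
    qed
    note img = this
    have "other_sizes (planted H 0) {0, 1} c = image_mset t (mset_set ?I)"
      unfolding other_sizes_def img using cls_Z Z(3) by (intro image_mset_cong) simp
    also have "\<dots> = mset_set (t ` ?I)" using t by (intro image_mset_mset_set) (simp add: bij_betw_def)
    also have "t ` ?I = S" using t by (simp add: bij_betw_def)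
    finally show ?thesis .
  qed
  ultimately show "mset_set S \<in> sizes (planted H 0) {0, 1}"
    unfolding sizes_def by (intro CollectI exI[of _ c]) simp
qed

text \<open>Restricting to distinct sizes reduces the count to subsets of an interval. Partitions of
  a single copy of \<open>H\<close> suffice: everything outside joins the root part.\<close>

lemma choose_edges_le_P:
  assumes G: "edges G = planted H b - {{0, 1}}" and k: "k \<ge> 2"
    and hubs: "\<And>i. 1 \<le> i \<Longrightarrow> i \<le> k \<Longrightarrow> hub_edges h i \<subseteq> H"
  shows "(card H div k + 1 - h) choose (k - 1) \<le> k * P G k"
proof -
  interpret pendant_edge "planted H b" "{0, 1}" 1 by (rule pendant_planted)
  define Q where "Q = {S. S \<subseteq> {h..card H div k} \<and> card S = k - 1}"
  define N where "N = mset_set ` Q"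
  have finS: "finite S" if "S \<in> Q" for S using that finite_subset unfolding Q_def by blast
  have "inj_on mset_set Q" by (rule inj_onI) (simp add: finS mset_set_eq_iff)
  then have "card N = card Q" by (simp add: N_def card_image)
  also have "\<dots> = (card H div k + 1 - h) choose (k - 1)"
    using n_subsets[of "{h..card H div k}" "k - 1"] by (simp add: Q_def)
  finally have "card N = (card H div k + 1 - h) choose (k - 1)" .
  moreover have "card N \<le> k * P G k"
  proof (rule card_sizes_le_P[OF G])
    fix \<mu> assume "\<mu> \<in> N"
    then obtain S where S: "S \<subseteq> {h..card H div k}" "card S = k - 1" "\<mu> = mset_set S"
      by (auto simp: N_def Q_def)
    note \<mu> = hub_parts_in_sizes[OF hubs k S(1,2), folded S(3)]
    have "1 \<le> card H" using star_edge finite_H by (auto simp: Suc_le_eq card_gt_0_iff)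
    moreover have "card (planted H 0) \<le> card (planted H b)"
      using strict_mono_less_eq[OF strict_mono_card_planted] by blast
    ultimately have "\<Sum>\<^sub># \<mu> + 2 \<le> card (planted H b)"
      using \<mu>(2) h card_planted_0 by linarith
    then show "\<mu> \<in> sizes (planted H b) {0, 1} \<and> size \<mu> + 1 = k \<and> \<Sum>\<^sub># \<mu> + 2 \<le> card (planted H b)"
      using sizes_planted_mono[OF \<mu>(1)] S k by simp
  qed
  ultimately show ?thesis by simp
qed

end

text \<open>Any set of \<open>e\<close> edges between the union of the required hub edges and the
  complete graph will do, so it suffices to bound the size of that union.\<close>

lemma base_graph_exists:
  assumes h: "h \<ge> 2" and e: "h - 1 \<le> e" "e \<le> h choose 2"
  shows "\<exists>H. base_graph H h \<and> card H = e \<and>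
    (k * h \<le> e \<longrightarrow> (\<forall>i. 1 \<le> i \<longrightarrow> i \<le> k \<longrightarrow> hub_edges h i \<subseteq> H))"
proof -
  define q where "q = (if k * h \<le> e then max 1 k else 1)"
  define B where "B = (\<Union>i\<in>{1..q}. hub_edges h i)"
  have "card B \<le> (\<Sum>i\<in>{1..q}. card (hub_edges h i))" unfolding B_def by (rule card_UN_le) simp
  also have "\<dots> \<le> (\<Sum>i\<in>{1..q}. h - 1)"
    using card_hub_edges_le[of h] by (intro sum_mono) (meson atLeastAtMost_iff diff_le_mono2 le_trans)
  also have "\<dots> = q * (h - 1)" by simp
  also have "\<dots> \<le> e"
  proof (cases "k * h \<le> e \<and> 1 \<le> k")
    case True
    then have "q * (h - 1) \<le> k * h" by (simp add: q_def max_def)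
    then show ?thesis using True by simp
  next
    case False
    then show ?thesis using e(1) by (auto simp: q_def)
  qed
  finally have "card B \<le> e" .
  moreover have "B \<subseteq> edges_on h" unfolding B_def by (rule UN_least) (simp add: hub_edges_subset)
  ultimately obtain H where H: "B \<subseteq> H" "H \<subseteq> edges_on h" "card H = e"
    using exists_subset_between[of B e "edges_on h"] e(2) finite_edges_on card_edges_on by auto
  have hub: "hub_edges h i \<subseteq> H" if "1 \<le> i" "i \<le> q" for i
  proof -
    have "hub_edges h i \<subseteq> B" unfolding B_def using that by (intro UN_upper) simp
    then show ?thesis using H(1) by blast
  qed
  have "base_graph H h" using H(2) hub[of 1] h by unfold_locales (simp_all add: q_def)
  moreover have "hub_edges h i \<subseteq> H" if "k * h \<le> e" "1 \<le> i" "i \<le> k" for i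
    using hub[of i] that by (simp add: q_def)
  ultimately show ?thesis using H(3) by blast
qed

section \<open>Choice of the parameters\<close>

lemma Suc_num_verts: "num_verts a + 1 = 2 ^ (a + 1)"
  by (induction a) (simp_all add: num_verts_def)

lemma half_le_ln_2: "1 / 2 \<le> ln (2 :: real)"
proof -
  have "1 \<le> ln (4 :: real)" using exp_le by (simp add: ln_ge_iff)
  moreover have "ln (4 :: real) = 2 * ln 2" using ln_realpow[of "2 :: real" 2] by simp
  ultimately show ?thesis by simp
qed

lemma ln_num_verts:
  assumes "a \<ge> 1"
  shows "real a / 2 \<le> ln (real (num_verts a))" and "ln (real (num_verts a)) \<le> real a + 1"
proof -
  have n: "real (num_verts a) = 2 ^ (a + 1) - 1"
    using arg_cong[OF Suc_num_verts[of a], of real] by simp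
  have "(2 :: real) ^ a \<le> real (num_verts a)" using n by simp
  moreover have pos: "0 < real (num_verts a)"
  proof -
    have "(1 :: real) \<le> 2 ^ a" by simp
    moreover have "real (num_verts a) = 2 * 2 ^ a - 1" using n by simp
    ultimately show ?thesis by linarith
  qed
  ultimately have "ln ((2 :: real) ^ a) \<le> ln (real (num_verts a))" by (subst ln_le_cancel_iff) simp_all
  moreover have "real a * (1 / 2) \<le> real a * ln 2" using half_le_ln_2 by (intro mult_left_mono) simp_all
  ultimately show "real a / 2 \<le> ln (real (num_verts a))" by (simp add: ln_realpow)
  have "ln (real (num_verts a)) \<le> ln (2 ^ (a + 1))" using n pos by simp
  also have "\<dots> = real (a + 1) * ln 2" by (rule ln_realpow)
  also have "\<dots> \<le> real (a + 1) * 1" using ln_le_minus_one[of "2 :: real"] by (intro mult_left_mono) simp_all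
  finally show "ln (real (num_verts a)) \<le> real a + 1" by simp
qed

text \<open>The binomial coefficient is at least \<open>(N / (k - 1)) ^ (k - 1)\<close>, and
  \<open>N / (k - 1)\<close> exceeds \<open>x / (8 * k^2)\<close> when
  \<open>x \<le> 8 * k * N\<close>. The outer division by \<open>k\<close> undoes the factor lost by
  passing to multisets.\<close>

definition lower_const :: "nat \<Rightarrow> real" where
  "lower_const k = (1 / (8 * real k ^ 2)) ^ (k - 1) / real k"

text \<open>The base 4 absorbs the estimate of \<open>e + b + 1\<close> by
  \<open>4 * (ln n + d^2)\<close>.\<close>

definition upper_const :: "nat \<Rightarrow> real" where
  "upper_const k = real (count_const (k - 1)) * 4 ^ (k - 1)"

lemma choose_lower_bound:
  assumes k: "k \<ge> 2" and N: "k - 1 \<le> N" and x: "0 \<le> x" "x \<le> 8 * real k * real N"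
    and P: "N choose (k - 1) \<le> k * p"
  shows "lower_const k * x ^ (k - 1) \<le> real p"
proof -
  have "x / (8 * real k ^ 2) \<le> real N / real k"
    using x(2) k by (simp add: field_simps power2_eq_square)
  also have "\<dots> \<le> real N / real (k - 1)" using k by (intro divide_left_mono) auto
  finally have "(x / (8 * real k ^ 2)) ^ (k - 1) \<le> (real N / real (k - 1)) ^ (k - 1)"
    using x(1) by (intro power_mono) simp_all
  also have "\<dots> \<le> real (N choose (k - 1))" by (rule binomial_ge_n_over_k_pow_k[OF N])
  also have "\<dots> \<le> real k * real p" using P by (simp flip: of_nat_mult)
  finally show ?thesis using k by (simp add: lower_const_def power_divide field_simps)
qed

text \<open>The threshold for \<open>a\<close> and both constants involve \<open>k\<close> only,
  which makes the bounds uniform in \<open>d\<close>. The degree ratio is bounded twice: by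
  expressions tending to 1 for growing \<open>d\<close>, and by fixed constants for the remaining
  case.\<close>

lemma graph_exists:
  fixes d :: real and k a :: nat
  assumes k: "k \<ge> 2" and a: "a \<ge> 1"
    and d: "2 - 2 / real (num_verts a) \<le> d" "d \<le> real (num_verts a) - 1"
  shows "\<exists>G :: nat ugraph. simple_graph G \<and> connected_graph G \<and> card (verts G) = num_verts a \<and>
    (128 * k\<^sup>2 \<le> a \<longrightarrow> lower_const k * (ln (real (num_verts a)) + d\<^sup>2) ^ (k - 1) \<le> real (P G k)) \<and>
    real (P G k) \<le> upper_const k * (ln (real (num_verts a)) + d\<^sup>2) ^ (k - 1) \<and>
    1 - 3 / d \<le> avg_degree G / d \<and> avg_degree G / d \<le> 1 + 4 / d \<and>
    1 / 4 \<le> avg_degree G / d \<and> avg_degree G / d \<le> 2"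
proof -
  define n where "n = real (num_verts a)"
  define L where "L = ln n"
  have n: "n = 2 ^ (a + 1) - 1"
    using arg_cong[OF Suc_num_verts[of a], of real] by (simp add: n_def)
  have "(2 :: real) ^ 2 \<le> 2 ^ (a + 1)" using a by (intro power_increasing) simp_all
  then have n3: "n \<ge> 3" using n by simp
  then have "2 / n \<le> 2 / 3" by (intro divide_left_mono) simp_all
  then have d43: "4 / 3 \<le> d" using d(1) by (simp add: n_def)
  \<comment> \<open>As \<open>num_verts a + 1\<close> is a power of two, copies of \<open>H\<close>
    fill the bottom of the tree exactly when \<open>h + 1\<close> is a power of two. Minimality of
    \<open>j\<close> keeps \<open>h\<close> from exceeding \<open>d\<close> by more than a factor of
    about two.\<close>
  define j where "j = (LEAST j. d \<le> 2 ^ j - 2)"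
  have top: "d \<le> 2 ^ (a + 1) - 2" using d(2) n by (simp add: n_def)
  have j: "d \<le> 2 ^ j - 2" "j \<le> a + 1"
    unfolding j_def using top by (rule LeastI, rule Least_le)
  have j2: "j \<ge> 2"
  proof (rule ccontr)
    assume "\<not> j \<ge> 2"
    then have "(2 :: real) ^ j \<le> 2 ^ 1" by (intro power_increasing) simp_all
    then show False using j(1) d43 by simp
  qed
  have jmin: "2 ^ (j - 1) < d + 2"
    using not_less_Least[of "j - 1" "\<lambda>j. d \<le> 2 ^ j - 2"] j2 by (simp add: j_def[symmetric])
  define h where "h = (2 :: nat) ^ j - 1"
  have h: "real h = 2 ^ j - 1" by (simp add: h_def of_nat_diff)
  have "(2 :: nat) ^ 2 \<le> 2 ^ j" using j2 by (intro power_increasing) simp_all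
  then have h3: "h \<ge> 3" by (simp add: h_def)
  have hd: "d + 1 \<le> real h" using j(1) h by simp
  have "(2 :: real) ^ j = 2 * 2 ^ (j - 1)" using j2 by (simp add: power_eq_if)
  then have hup: "real h \<le> 2 * d + 3" using h jmin by simp
  define b where "b = a + 1 - j"
  have pow: "2 ^ b * (h + 1) = 2 ^ (a + 1)"
    using j(2) by (simp add: h_def b_def flip: power_add)
  define e where "e = nat \<lfloor>real h * d / 2\<rfloor>"
  have hd0: "0 \<le> real h * d / 2" using d43 by simp
  have e: "real e \<le> real h * d / 2" "real h * d / 2 < real e + 1"
  proof -
    have "real e = real_of_int \<lfloor>real h * d / 2\<rfloor>" using hd0 by (simp add: e_def)
    then show "real e \<le> real h * d / 2" "real h * d / 2 < real e + 1"
      using of_int_floor_le[of "real h * d / 2"] real_of_int_floor_add_one_gt[of "real h * d / 2"]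
      by linarith+
  qed
  \<comment> \<open>The admissible range of \<open>d\<close> is just what \<open>H\<close> requires:
    \<open>d \<ge> 2 - 2 / n \<ge> 2 - 2 / h\<close> gives enough edges for a star, and
    \<open>d \<le> h - 1\<close> at most those of a complete graph.\<close>
  have "real h \<le> n"
    unfolding n h using power_increasing[OF j(2), of "2 :: real"] by simp
  then have "2 / n \<le> 2 / real h" using h3 by (intro divide_left_mono) simp_all
  then have "2 - 2 / real h \<le> d" using d(1) by (simp add: n_def)
  then have "real h * (2 - 2 / real h) \<le> real h * d" by (intro mult_left_mono) simp_all
  then have "real h - 1 \<le> real h * d / 2" using h3 by (simp add: algebra_simps)
  then have "real h < real e + 2" using e(2) by linarith
  then have e1: "h - 1 \<le> e" by linarith
  have "real h * d \<le> real h * (real h - 1)" using hd by (intro mult_left_mono) simp_all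
  then have "2 * real e \<le> real h * (real h - 1)" using e(1) by linarith
  then have "real (2 * e) \<le> real (h * (h - 1))" using h3 by (simp add: of_nat_diff)
  then have "2 * e \<le> h * (h - 1)" by (simp only: of_nat_le_iff)
  then have e2: "e \<le> h choose 2" by (simp add: choose_two)
  obtain H where base: "base_graph H h" and card_H: "card H = e"
    and hubs: "k * h \<le> e \<Longrightarrow> 1 \<le> i \<Longrightarrow> i \<le> k \<Longrightarrow> hub_edges h i \<subseteq> H" for i
    using base_graph_exists[OF _ e1 e2, of k] h3 by auto
  interpret base_graph H h by (rule base)
  define G :: "nat ugraph" where
    "G = \<lparr>verts = {1..2 ^ b * (h + 1) - 1}, edges = planted H b - {{0, 1}}\<rparr>"
  have G: "edges G = planted H b - {{0, 1}}" "verts G = {1..2 ^ b * (h + 1) - 1}"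
    by (simp_all add: G_def)
  have card_verts: "card (verts G) = num_verts a"
  proof -
    have "card (verts G) = 2 ^ (a + 1) - 1" unfolding G(2) pow by simp
    then show ?thesis using Suc_num_verts[of a] by linarith
  qed
  define B where "B = (2 :: real) ^ b"
  have B: "B \<ge> 1" by (simp add: B_def)
  have "card (edges G) + 1 = card (planted H b)"
    unfolding G(1) using card.remove[OF finite_planted[OF H] root_in_planted[OF H]] by simp
  then have "card (edges G) + 2 = 2 ^ b * (e + 2)" using card_planted[of b] card_H by simp
  then have "real (card (edges G) + 2) = real (2 ^ b * (e + 2))" by (simp only:)
  then have "real (card (edges G)) = B * (real e + 2) - 2" by (simp add: B_def algebra_simps)
  then have avg: "avg_degree G = 2 * (B * (real e + 2) - 2) / n"
    by (simp add: avg_degree_def card_verts n_def)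
  have nB: "n = B * (real h + 1) - 1"
    using arg_cong[OF pow, of real] by (simp add: n B_def algebra_simps)
  have h3r: "3 \<le> real h" using h3 by simp
  have hd4: "4 \<le> real h * d" using mult_mono[OF h3r d43] by simp
  \<comment> \<open>\<open>n\<close> lies between \<open>B * h\<close> and
    \<open>B * (h + 1)\<close>. Using the former here and the latter for the lower estimate cancels
    the number \<open>B\<close> of copies.\<close>
  have up: "avg_degree G \<le> d + 4 / real h"
  proof -
    have "B * (2 * real e) \<le> B * (real h * d)" using e(1) B by (intro mult_left_mono) simp_all
    then have "2 * (B * (real e + 2) - 2) \<le> B * (real h * d + 4)" by (simp add: algebra_simps)
    also have "\<dots> = (d + 4 / real h) * (B * real h)" using h3r by (simp add: field_simps)
    also have "\<dots> \<le> (d + 4 / real h) * n"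
      using nB B d43 by (intro mult_left_mono) (simp_all add: algebra_simps)
    finally show ?thesis unfolding avg using n3 by (simp add: divide_le_eq)
  qed
  have low: "(real h * d - 2) / (real h + 1) \<le> avg_degree G"
  proof -
    have "B * (real h * d - 2) \<le> B * (2 * real e)" using e(2) B by (intro mult_left_mono) simp_all
    then have num: "B * (real h * d - 2) \<le> 2 * (B * (real e + 2) - 2)"
      using B by (simp add: algebra_simps)
    have "(real h * d - 2) / (real h + 1) = B * (real h * d - 2) / (B * (real h + 1))" using B by simp
    also have "\<dots> \<le> B * (real h * d - 2) / n"
      using nB n3 B hd4 by (intro divide_left_mono) simp_all
    also have "\<dots> \<le> avg_degree G" unfolding avg using num n3 by (intro divide_right_mono) simp_all
    finally show ?thesis .
  qed
  have d0: "d > 0" using d43 by simp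
  have "d + 4 / real h \<le> d + 4" using h3r by (simp add: divide_le_eq)
  then have "avg_degree G \<le> d + 4" using up by simp
  then have r1: "avg_degree G / d \<le> 1 + 4 / d" using d0 by (simp add: field_simps)
  have "4 / real h \<le> 4 / 3" using h3r by (intro divide_left_mono) simp_all
  then have "avg_degree G \<le> 2 * d" using up d43 by simp
  then have r2: "avg_degree G / d \<le> 2" using d0 by (simp add: field_simps)
  have "d - 3 \<le> (real h * d - 2) / (real h + 1)"
    using h3r hd by (simp add: le_divide_eq algebra_simps)
  then have "d - 3 \<le> avg_degree G" using low by simp
  then have "(d - 3) / d \<le> avg_degree G / d" using d0 by (intro divide_right_mono) simp_all
  then have r3: "1 - 3 / d \<le> avg_degree G / d" using d0 by (simp add: diff_divide_distrib)
  have d3: "3 * d \<le> real h * d" using h3r d0 by (intro mult_right_mono) simp_all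
  have "(real h * d + d) / 4 \<le> real h * d - 2"
  proof -
    have "(p + d) / 4 \<le> p - 2" if "3 * d \<le> p" "4 \<le> p" for p :: real using that by simp
    then show ?thesis using d3 hd4 by blast
  qed
  moreover have "d / 4 * (real h + 1) = (real h * d + d) / 4" by (simp add: algebra_simps)
  ultimately have "d / 4 * (real h + 1) \<le> real h * d - 2" by (simp only:)
  then have "d / 4 \<le> (real h * d - 2) / (real h + 1)" using h3r by (simp add: le_divide_eq)
  then have "d / 4 \<le> avg_degree G" using low by (rule order_trans)
  then have r4: "1 / 4 \<le> avg_degree G / d" using d0 by (simp add: field_simps)
  have L: "real a / 2 \<le> L" "L \<le> real a + 1" using ln_num_verts[OF a] by (simp_all add: L_def n_def)
  have upper: "real (P G k) \<le> upper_const k * (L + d\<^sup>2) ^ (k - 1)"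
  proof -
    have "real h * d \<le> (2 * d + 3) * d" using hup d0 by (intro mult_right_mono) simp_all
    moreover have "(2 * d + 3) * d = 2 * d\<^sup>2 + 3 * d" by (simp add: power2_eq_square algebra_simps)
    moreover have "d \<le> d\<^sup>2" using d43 by (simp add: power2_eq_square)
    moreover have "b + 1 \<le> a" using j2 a by (simp add: b_def)
    then have "real b + 1 \<le> real a" by linarith
    \<comment> \<open>Here \<open>e \<le> h * d / 2 \<le> d^2 + 3 * d / 2 \<le> 5 / 2 * d^2\<close>
      and \<open>b + 1 \<le> a \<le> 2 * L\<close>.\<close>
    ultimately have D: "real e + real b + 1 \<le> 4 * (L + d\<^sup>2)"
      using e(1) L(1) zero_le_power2[of d] unfolding distrib_left by linarith
    have "real (P G k) \<le> real (count_const (k - 1) * (e + b + 1) ^ (k - 1))"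
      using P_le[OF G(1)] k card_H by (simp only: of_nat_le_iff)
    also have "\<dots> = real (count_const (k - 1)) * real (e + b + 1) ^ (k - 1)" by simp
    also have "\<dots> \<le> real (count_const (k - 1)) * (4 * (L + d\<^sup>2)) ^ (k - 1)"
      using D by (intro mult_left_mono power_mono) simp_all
    finally show ?thesis by (simp only: upper_const_def power_mult_distrib mult.assoc)
  qed
  have lower: "lower_const k * (L + d\<^sup>2) ^ (k - 1) \<le> real (P G k)" if large: "128 * k\<^sup>2 \<le> a"
  proof -
    have "real (128 * k\<^sup>2) \<le> real a" using large by (rule of_nat_mono)
    then have large': "128 * (real k)\<^sup>2 \<le> real a" by simp
    have kk: "real k \<le> (real k)\<^sup>2" "2 \<le> real k" using k by (simp_all add: power2_eq_square)
    have nonneg: "0 \<le> L + d\<^sup>2" using L(1) by simp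
    show ?thesis
    proof (cases "d\<^sup>2 \<le> L")
      case True
      \<comment> \<open>From \<open>d^2 \<le> L \<le> a + 1\<close>. Together with
        \<open>j \<le> 2 ^ (j - 1) < d + 2\<close> it shows that the copies of \<open>H\<close>
        replace so few levels that at least \<open>a / 2\<close> remain for cutting.\<close>
      have "d \<le> real a / 4"
      proof (rule ccontr)
        assume "\<not> d \<le> real a / 4"
        then have "(real a / 4)\<^sup>2 < d\<^sup>2" by (intro power_strict_mono) simp_all
        then have "real a * real a < 16 * (real a + 1)" using True L(2) by (simp add: power2_eq_square)
        moreover have "128 \<le> real a" using large' kk by linarith
        then have "128 * real a \<le> real a * real a" by (intro mult_right_mono) simp_all
        ultimately have "128 * real a < 16 * (real a + 1)" by (rule le_less_trans[rotated])
        then show False using \<open>128 \<le> real a\<close> by simp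
      qed
      moreover have "j - 1 < 2 ^ (j - 1)" by (rule less_exp)
      then have "real j \<le> real (2 ^ (j - 1))" by (intro of_nat_mono) linarith
      then have "real j \<le> 2 ^ (j - 1)" by simp
      ultimately have "real j < real a / 4 + 2" using jmin by linarith
      moreover have "real b = real a + 1 - real j" using j(2) by (simp add: b_def of_nat_diff)
      ultimately have bhalf: "real a / 2 \<le> real b" using large' kk by linarith
      show ?thesis
      proof (rule choose_lower_bound[OF k])
        have "real (k - 1) \<le> real b" using bhalf large' kk by linarith
        then show "k - 1 \<le> b" by (simp only: of_nat_le_iff)
        have "L + d\<^sup>2 \<le> 8 * real b" using True L(2) bhalf large' kk by linarith
        also have "\<dots> \<le> 8 * real k * real b" using kk by (simp add: mult_right_mono)
        finally show "L + d\<^sup>2 \<le> 8 * real k * real b" .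
        show "b choose (k - 1) \<le> k * P G k" using choose_levels_le_P[OF G(1)] k by simp
      qed (rule nonneg)
    next
      case False
      \<comment> \<open>Origin of the threshold: now \<open>d^2\<close> exceeds
        \<open>L \<ge> a / 2\<close>, and \<open>a \<ge> 128 * k^2\<close> turns this into
        \<open>d \<ge> 8 * k\<close>. Thus \<open>H\<close> has room for \<open>k\<close> hubs, and
        removing \<open>h\<close> from the range of sizes costs only a constant factor.\<close>
      have d8': "(8 * real k)\<^sup>2 \<le> d\<^sup>2" using False L(1) large' by (simp add: power2_eq_square)
      then have d8: "8 * real k \<le> d" by (rule power2_le_imp_le) (rule less_imp_le[OF d0])
      define N where "N = e div k + 1 - h"
      define x where "x = real k * real h"
      define p where "p = real h * d"
      have p: "8 * x \<le> p" using mult_left_mono[OF d8, of "real h"] by (simp add: x_def p_def mult_ac)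
      have x: "1 \<le> x" unfolding x_def using mult_mono[OF kk(2) h3r] by simp
      have ep: "p / 2 < real e + 1" using e(2) by (simp add: p_def)
      have "x \<le> real e" using ep p x by linarith
      then have "real (k * h) \<le> real e" by (simp add: x_def)
      then have khe: "k * h \<le> e" by (simp only: of_nat_le_iff)
      have "e < k * (e div k + 1)" using k dividend_less_times_div[of k e] by simp
      then have "real e < real (k * (e div k + 1))" by (simp only: of_nat_less_iff)
      then have ediv: "real e < real k * (real (e div k) + 1)" by (simp add: distrib_left)
      have "real (e div k) + 1 \<le> real N + real h" by (simp add: N_def)
      then have "real k * (real (e div k) + 1) \<le> real k * (real N + real h)"
        by (rule mult_left_mono) simp
      also have "\<dots> = real k * real N + x" by (simp add: x_def distrib_left)
      finally have "real e < real k * real N + x" using ediv by (rule less_le_trans[rotated])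
      \<comment> \<open>\<open>k * N\<close> exceeds \<open>e - x > p / 2 - 1 - x\<close>, and both
        \<open>1 \<le> x\<close> and \<open>x\<close> are at most \<open>p / 8\<close>, which leaves
        at least \<open>p / 4\<close>.\<close>
      then have pN: "p \<le> 4 * (real k * real N)" using ep p x by linarith
      have "d * d \<le> p" unfolding p_def using hd d0 by (intro mult_right_mono) simp_all
      then have N: "d\<^sup>2 \<le> 4 * (real k * real N)" using pN by (simp only: power2_eq_square)
      show ?thesis
      proof (rule choose_lower_bound[OF k])
        have "(8 * real k)\<^sup>2 = 4 * (real k * (16 * real k))" by (simp add: power2_eq_square)
        then have "real k * (16 * real k) \<le> real k * real N" using N d8' by linarith
        then have "16 * real k \<le> real N" by (rule mult_left_le_imp_le) (use kk in simp)
        then have "real (k - 1) \<le> real N" using kk by linarith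
        then show "k - 1 \<le> N" by (simp only: of_nat_le_iff)
        have "8 * real k * real N = 8 * (real k * real N)" by simp
        then show "L + d\<^sup>2 \<le> 8 * real k * real N" using N False by linarith
        show "N choose (k - 1) \<le> k * P G k"
          using choose_edges_le_P[OF G(1) k hubs[OF khe]] card_H by (simp add: N_def)
      qed (rule nonneg)
    qed
  qed
  show ?thesis
    using tree_graph[OF G] card_verts upper lower r1 r2 r3 r4
    by (intro exI[of _ G]) (simp add: L_def n_def)
qed

theorem theorem6:
  fixes k :: nat
  assumes "k \<ge> 2"
  shows "\<exists>c C. \<forall>d :: nat \<Rightarrow> real.
    (\<forall>a\<ge>1. 2 - 2 / real (num_verts a) \<le> d a \<and> d a \<le> real (num_verts a) - 1) \<longrightarrow>
    (\<exists>G :: nat \<Rightarrow> nat ugraph.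
      (\<forall>a\<ge>1. simple_graph (G a) \<and> connected_graph (G a) \<and> card (verts (G a)) = num_verts a) \<and>
      Theta_with c C (\<lambda>a. real (P (G a) k)) (\<lambda>a. (ln (real (num_verts a)) + (d a)\<^sup>2) ^ (k - 1)) \<and>
      (if filterlim d at_top sequentially
       then (\<lambda>a. avg_degree (G a) / d a) \<longlonglongrightarrow> 1
       else (\<exists>c' C'. Theta_with c' C' (\<lambda>a. avg_degree (G a) / d a) (\<lambda>_. 1))))"
\<comment> \<open>The constants are fixed before \<open>d\<close> is introduced, since they depend
  on \<open>k\<close> alone.\<close>
proof (rule exI[of _ "lower_const k"], rule exI[of _ "upper_const k"], intro allI impI)
  fix d :: "nat \<Rightarrow> real"
  assume d: "\<forall>a\<ge>1. 2 - 2 / real (num_verts a) \<le> d a \<and> d a \<le> real (num_verts a) - 1"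
  define good where "good G a \<longleftrightarrow> simple_graph G \<and> connected_graph G \<and> card (verts G) = num_verts a \<and>
    (128 * k\<^sup>2 \<le> a \<longrightarrow> lower_const k * (ln (real (num_verts a)) + (d a)\<^sup>2) ^ (k - 1) \<le> real (P G k)) \<and>
    real (P G k) \<le> upper_const k * (ln (real (num_verts a)) + (d a)\<^sup>2) ^ (k - 1) \<and>
    1 - 3 / d a \<le> avg_degree G / d a \<and> avg_degree G / d a \<le> 1 + 4 / d a \<and>
    1 / 4 \<le> avg_degree G / d a \<and> avg_degree G / d a \<le> 2" for G :: "nat ugraph" and a
  \<comment> \<open>With the implication under the quantifier a graph can be chosen for every
    \<open>a\<close>, including the unconstrained \<open>a = 0\<close>.\<close>
  have "\<exists>G. a \<ge> 1 \<longrightarrow> good G a" for a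
    using graph_exists[OF assms, of a "d a"] d unfolding good_def by blast
  then obtain G where G: "\<And>a. a \<ge> 1 \<Longrightarrow> good (G a) a" by metis
  have ev1: "\<forall>\<^sub>F a in sequentially. a \<ge> 1" by (rule eventually_ge_at_top)
  have "Theta_with (lower_const k) (upper_const k) (\<lambda>a. real (P (G a) k))
      (\<lambda>a. (ln (real (num_verts a)) + (d a)\<^sup>2) ^ (k - 1))"
    unfolding Theta_with_def
  proof (intro conjI)
    show "0 < lower_const k" using assms by (simp add: lower_const_def)
    have "lower_const k \<le> 1"
    proof -
      have "1 \<le> 8 * real k ^ 2"
        using assms mult_mono[of 1 "real k" 1 "real k"] by (simp add: power2_eq_square)
      then have "1 / (8 * real k ^ 2) \<le> 1" using assms by (subst divide_le_eq_1_pos) simp_all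
      then have "(1 / (8 * real k ^ 2)) ^ (k - 1) \<le> 1" by (intro power_le_one) simp_all
      then show ?thesis using assms by (simp add: lower_const_def)
    qed
    also have "1 \<le> upper_const k"
      unfolding upper_const_def using count_const_pos[of "k - 1"] one_le_power[of "4 :: real" "k - 1"]
        mult_mono[of 1 "real (count_const (k - 1))" 1 "4 ^ (k - 1)"] by simp
    finally show "lower_const k \<le> upper_const k" .
    show "\<forall>\<^sub>F a in sequentially.
       lower_const k * (ln (real (num_verts a)) + (d a)\<^sup>2) ^ (k - 1) \<le> real (P (G a) k) \<and>
       real (P (G a) k) \<le> upper_const k * (ln (real (num_verts a)) + (d a)\<^sup>2) ^ (k - 1)"
      using ev1 eventually_ge_at_top[of "128 * k\<^sup>2"]
      by eventually_elim (use G in \<open>auto simp: good_def\<close>)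
  qed
  moreover have "(\<lambda>a. avg_degree (G a) / d a) \<longlonglongrightarrow> 1" if lim: "filterlim d at_top sequentially"
  proof (rule tendsto_sandwich)
    have inv: "(\<lambda>a. x / d a) \<longlonglongrightarrow> 0" for x :: real
      using lim by (rule real_tendsto_divide_at_top[OF tendsto_const])
    show "(\<lambda>a. 1 - 3 / d a) \<longlonglongrightarrow> 1" using tendsto_diff[OF tendsto_const inv, of 1 3] by simp
    show "(\<lambda>a. 1 + 4 / d a) \<longlonglongrightarrow> 1" using tendsto_add[OF tendsto_const inv, of 1 4] by simp
    show "\<forall>\<^sub>F a in sequentially. 1 - 3 / d a \<le> avg_degree (G a) / d a"
      using ev1 by eventually_elim (use G in \<open>auto simp: good_def\<close>)
    show "\<forall>\<^sub>F a in sequentially. avg_degree (G a) / d a \<le> 1 + 4 / d a"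
      using ev1 by eventually_elim (use G in \<open>auto simp: good_def\<close>)
  qed
  \<comment> \<open>The fixed bounds hold for every admissible \<open>d\<close>, so the case of
    \<open>d\<close> not tending to infinity requires no analysis of its behaviour.\<close>
  moreover have "Theta_with (1 / 4) 2 (\<lambda>a. avg_degree (G a) / d a) (\<lambda>_. 1)"
    unfolding Theta_with_def
  proof (intro conjI)
    show "\<forall>\<^sub>F a in sequentially. 1 / 4 * 1 \<le> avg_degree (G a) / d a \<and> avg_degree (G a) / d a \<le> 2 * 1"
      using ev1 by eventually_elim (use G in \<open>auto simp: good_def\<close>)
  qed simp_all
  ultimately show "\<exists>G :: nat \<Rightarrow> nat ugraph.
      (\<forall>a\<ge>1. simple_graph (G a) \<and> connected_graph (G a) \<and> card (verts (G a)) = num_verts a) \<and>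
      Theta_with (lower_const k) (upper_const k) (\<lambda>a. real (P (G a) k))
        (\<lambda>a. (ln (real (num_verts a)) + (d a)\<^sup>2) ^ (k - 1)) \<and>
      (if filterlim d at_top sequentially
       then (\<lambda>a. avg_degree (G a) / d a) \<longlonglongrightarrow> 1
       else (\<exists>c' C'. Theta_with c' C' (\<lambda>a. avg_degree (G a) / d a) (\<lambda>_. 1)))"
    using G unfolding good_def by (intro exI[of _ G]) auto
qed

end
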